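(* Let $p$ be an odd prime and let $\lambda=(\lambda_1,\dots,\lambda_n)$, $\lambda_n\neq0$, be a ${\bf T}$-regular partition with ${\bf T}$-conjugate $\gamma=(\gamma_1,\dots,\gamma_m)$ of length $m$. Let $\epsilon(\lambda)=\sum_{j=1}^{\lfloor m/2\rfloor}(-1)^{j-1}\gamma_{2j}$. (i) $P(R)\,s(\lambda)=(-1)^{\epsilon(\lambda)}P(R)\,v(\lambda)=p(\lambda')$, where $P(R)$ is the Milnor spike associated to $(\lambda_2,\dots,\lambda_n)$. (ii) If $\lambda=(p-1)\kappa$, where $\kappa$ is a column $2$-regular partition, then $P(S)\,w(\lambda')=p(\lambda')$, where $P(S)$ is the Milnor spike associated to $(\gamma_2,\dots,\gamma_m)$. (iii) The corresponding formulae hold for the Milnor spikes associated to $\lambda$ and $\gamma$, with $p(\lambda')$ replaced by $p(\lambda')^p$: if $P(R_0)$ is the Milnor spike associated to $\lambda$, then $P(R_0)s(\lambda)=(-1)^{\epsilon(\lambda)}P(R_0)v(\lambda)=p(\lambda')^p$; and if $\lambda=(p-1)\kappa$ with $\kappa$ column $2$-regular and $P(S_0)$ is the Milnor spike associated to $\gamma$, then $P(S_0)w(\lambda')=p(\lambda')^p$.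
   Context: ${\bf P}=\mathbb{F}_p[x_1,\dots,x_n]$, graded with each $x_i$ in degree $1$, is a left module over $\mathcal{A}_p$, the algebra of Steenrod $p$th powers (no Bocksteins). For a finite sequence $R=(r_1,\dots,r_t)$ of non-negative integers, $P(R)\in\mathcal{A}_p$ is the Milnor basis element, which raises polynomial degree by $\sum_i(p^i-1)r_i$. Its action on ${\bf P}$ is characterized by: with indeterminates $\tau_1,\tau_2,\dots$, the map $f\mapsto\sum_R\big(\prod_i\tau_i^{r_i}\big)P(R)f$ is the $\mathbb{F}_p$-algebra homomorphism sending $x_j$ to $x_j+\sum_{i\ge1}\tau_ix_j^{p^i}$. In particular $P(r)=P^r$, and $P$ of the empty sequence is $1$. A partition $\kappa=(\kappa_1,\dots,\kappa_n)$ is column $q$-regular if $0\le\kappa_i-\kappa_{i+1}\le q-1$ for $1\le i\le n$ (with $\kappa_{n+1}=0$). $(p-1)\kappa$ has parts $(p-1)\kappa_i$. $\lambda$ is ${\bf T}$-regular if it is column $p$-regular and for every $a\ge1$ there is at most one $i$ with $(a-1)(p-1)<\lambda_i<a(p-1)$. Its diagram is the set of boxes $(i,j)$, $1\le i\le n$, $1\le j\le\lambda_i$ (row $i$, column $j$). Divide the diagram into consecutive blocks of $p-1$ columns (the last may have fewer); $\lambda_{(j)}$ is the partition whose diagram is the $j$th block, $\gamma_j$ is the number of its boxes, $m$ is the number of nonempty blocks, and $\gamma=(\gamma_1,\dots,\gamma_m)$ is the ${\bf T}$-conjugate of $\lambda$. Milnor spike: the Milnor spike associated to a sequence $(c_1,\dots,c_t)$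 of positive integers is $P(R)$ with $R=((b_1+1)p^{a_1}-1,\dots,(b_t+1)p^{a_t}-1)$, where $c_i=a_i(p-1)+b_i$, $a_i\ge0$, $1\le b_i\le p-1$. $[x_{i_1}^{s_1},\dots,x_{i_k}^{s_k}]$ denotes the $k\times k$ determinant with $(a,b)$ entry $x_{i_b}^{s_a}$, and $w(k)=[x_1,x_2^p,\dots,x_k^{p^{k-1}}]$. The $k$th antidiagonal ($1\le k\le\gamma_1$) of the diagram of $\lambda$ is the set of boxes $(i,j)$ with $j+i(p-1)=k+p-1$. If its lowest box is in row $i$ and its highest box is in row $i-s+1$, put $v_k(\lambda)=[x_{i-s+1},x_{i-s+2}^p,\dots,x_i^{p^{s-1}}]$; $v(\lambda)=\prod_{k=1}^{\gamma_1}v_k(\lambda)$. $s(\lambda)$ is the leading monomial of $v(\lambda)$, i.e. the monomial occurring in it (ignoring its coefficient) whose exponent vector is highest in left lexicographic order. For a partition $\mu$ with conjugate $\mu'$, $w(\mu')=\prod_{j=1}^{\mu_1}w(\mu'_j)$. Finally $p(\lambda')=\prod_{j=1}^m w(\lambda_{(j)}')^{p^{j-1}}$, where $\lambda_{(j)}'$ is the conjugate of $\lambda_{(j)}$. *)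

theory Defs
  imports "HOL-Computational_Algebra.Primes" "HOL-Library.Poly_Mapping" "Jordan_Normal_Form.Determinant"
begin

text \<open>
  Polynomials are finitely supported functions from monomials to coefficients, a monomial being
  the finitely supported function of its exponents.  The variables \<open>x\<^sub>1, x\<^sub>2, \<dots>\<close> carry indices
  from 1 on (index 0 is never used), and \<open>\<bbbF>\<^sub>p[x\<^sub>1,\<dots>,x\<^sub>n]\<close> is the subring of those polynomials in
  which only \<open>x\<^sub>1,\<dots>,x\<^sub>n\<close> occur; it is stable under all the operations below.  The prime field is
  any field type of cardinality \<open>p\<close>.
\<close>

type_synonym 'k mpoly = "(nat \<Rightarrow>\<^sub>0 nat) \<Rightarrow>\<^sub>0 'k"

definition cst :: "'a::zero \<Rightarrow> 'a mpoly" where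
  "cst c = Poly_Mapping.single 0 c"

definition var :: "nat \<Rightarrow> 'a::zero_neq_one mpoly" where
  "var i = Poly_Mapping.single (Poly_Mapping.single i 1) 1"

text \<open>
  Finite sequences of naturals (partitions included) are lists; \<open>part xs i\<close> is the \<open>i\<close>th entry,
  counted from 1, and is 0 outside \<open>1 \<le> i \<le> length xs\<close>.
\<close>

definition part :: "nat list \<Rightarrow> nat \<Rightarrow> nat" where
  "part xs i = (if 1 \<le> i \<and> i \<le> length xs then xs ! (i - 1) else 0)"

text \<open>
  \<open>total_op p t\<close> is the algebra homomorphism \<open>\<bbbF>\<^sub>p[x\<^sub>1,x\<^sub>2,\<dots>] \<rightarrow> \<bbbF>\<^sub>p[x\<^sub>1,x\<^sub>2,\<dots>][\<tau>\<^sub>1,\<dots>,\<tau>\<^sub>t]\<close> that sends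
  \<open>x\<^sub>j\<close> to \<open>x\<^sub>j + (\<Sum>i=1..t. \<tau>\<^sub>i x\<^sub>j\<^bsup>p^i\<^esup>)\<close>: the total operation with \<open>\<tau>\<^sub>i\<close> set to 0 for \<open>i > t\<close>.  This
  does not affect the coefficients of monomials in \<open>\<tau>\<^sub>1,\<dots>,\<tau>\<^sub>t\<close>, so the coefficient of
  \<open>\<Prod>i. \<tau>\<^sub>i\<^bsup>r\<^sub>i\<^esup>\<close> in \<open>total_op p t f\<close> is \<open>P(R) f\<close> for \<open>R = (r\<^sub>1,\<dots>,r\<^sub>t)\<close>.  In the
  target, \<open>\<tau>\<^sub>i\<close> is the outer variable \<open>var i\<close> and \<open>x\<^sub>j\<close> the constant \<open>cst (var j)\<close>.
\<close>

definition total_op :: "nat \<Rightarrow> nat \<Rightarrow> 'k::comm_ring_1 mpoly \<Rightarrow> 'k mpoly mpoly" where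
  "total_op p t f =
     (\<Sum>e\<in>Poly_Mapping.keys f. cst (cst (Poly_Mapping.lookup f e)) *
        (\<Prod>j\<in>Poly_Mapping.keys e.
           (cst (var j) + (\<Sum>i=1..t. var i * cst (var j ^ (p ^ i)))) ^ Poly_Mapping.lookup e j))"

definition milnor :: "nat \<Rightarrow> nat list \<Rightarrow> 'k::comm_ring_1 mpoly \<Rightarrow> 'k mpoly" where
  "milnor p R f =
     Poly_Mapping.lookup (total_op p (length R) f)
       (\<Sum>i=1..length R. Poly_Mapping.single i (part R i))"

text \<open>
  For \<open>c > 0\<close> the unique \<open>a, b\<close> with \<open>c = a (p - 1) + b\<close> and \<open>1 \<le> b \<le> p - 1\<close> are
  \<open>a = (c - 1) div (p - 1)\<close> and \<open>b = (c - 1) mod (p - 1) + 1\<close>.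
\<close>

definition spike_entry :: "nat \<Rightarrow> nat \<Rightarrow> nat" where
  "spike_entry p c =
     (let a = (c - 1) div (p - 1); b = (c - 1) mod (p - 1) + 1 in (b + 1) * p ^ a - 1)"

definition milnor_spike :: "nat \<Rightarrow> nat list \<Rightarrow> 'k::comm_ring_1 mpoly \<Rightarrow> 'k mpoly" where
  "milnor_spike p cs = milnor p (map (spike_entry p) cs)"

text \<open>Partitions may have trailing zero parts; the first clause says that the parts decrease.\<close>

definition column_regular :: "nat \<Rightarrow> nat list \<Rightarrow> bool" where
  "column_regular q \<kappa> \<longleftrightarrow>
     (\<forall>i\<in>{1..length \<kappa>}. part \<kappa> (i + 1) \<le> part \<kappa> i \<and> part \<kappa> i - part \<kappa> (i + 1) \<le> q - 1)"

definition T_regular :: "nat \<Rightarrow> nat list \<Rightarrow> bool" where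
  "T_regular p lam \<longleftrightarrow> column_regular p lam \<and>
     (\<forall>a\<ge>1. card {i \<in> {1..length lam}. (a - 1) * (p - 1) < part lam i \<and> part lam i < a * (p - 1)} \<le> 1)"

definition diagram :: "nat list \<Rightarrow> (nat \<times> nat) set" where
  "diagram lam = {(i, j). 1 \<le> i \<and> i \<le> length lam \<and> 1 \<le> j \<and> j \<le> part lam i}"

definition conj_partition :: "nat list \<Rightarrow> nat list" where
  "conj_partition \<mu> = map (\<lambda>j. card {i. (i, j) \<in> diagram \<mu>}) [1..<part \<mu> 1 + 1]"

definition block :: "nat \<Rightarrow> nat list \<Rightarrow> nat \<Rightarrow> (nat \<times> nat) set" where
  "block p lam a = {(i, j) \<in> diagram lam. (a - 1) * (p - 1) < j \<and> j \<le> a * (p - 1)}"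

definition block_partition :: "nat \<Rightarrow> nat list \<Rightarrow> nat \<Rightarrow> nat list" where
  "block_partition p lam a = map (\<lambda>i. card {j. (i, j) \<in> block p lam a}) [1..<length lam + 1]"

definition num_blocks :: "nat \<Rightarrow> nat list \<Rightarrow> nat" where
  "num_blocks p lam = card {a. 1 \<le> a \<and> block p lam a \<noteq> {}}"

definition T_conjugate :: "nat \<Rightarrow> nat list \<Rightarrow> nat list" where
  "T_conjugate p lam = map (\<lambda>a. card (block p lam a)) [1..<num_blocks p lam + 1]"

definition eps :: "nat \<Rightarrow> nat list \<Rightarrow> int" where
  "eps p lam =
     (\<Sum>j=1..num_blocks p lam div 2. (-1) ^ (j - 1) * int (part (T_conjugate p lam) (2 * j)))"

text \<open>\<open>bracket [(i\<^sub>1, s\<^sub>1), \<dots>, (i\<^sub>k, s\<^sub>k)]\<close> is \<open>[x\<^bsub>i\<^sub>1\<^esub>\<^bsup>s\<^sub>1\<^esup>, \<dots>, x\<^bsub>i\<^sub>k\<^esub>\<^bsup>s\<^sub>k\<^esup>]\<close>.\<close>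

definition bracket :: "(nat \<times> nat) list \<Rightarrow> 'k::comm_ring_1 mpoly" where
  "bracket xs =
     det (mat (length xs) (length xs) (\<lambda>(a, b). var (fst (xs ! b)) ^ snd (xs ! a)))"

definition w_poly :: "nat \<Rightarrow> nat \<Rightarrow> 'k::comm_ring_1 mpoly" where
  "w_poly p k = bracket (map (\<lambda>a. (a + 1, p ^ a)) [0..<k])"

definition w_prod :: "nat \<Rightarrow> nat list \<Rightarrow> 'k::comm_ring_1 mpoly" where
  "w_prod p \<nu> = (\<Prod>k\<leftarrow>\<nu>. w_poly p k)"

definition antidiagonal :: "nat \<Rightarrow> nat list \<Rightarrow> nat \<Rightarrow> (nat \<times> nat) set" where
  "antidiagonal p lam k = {(i, j) \<in> diagram lam. j + i * (p - 1) = k + p - 1}"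

text \<open>Rows are numbered from the top, so the lowest box has the largest row index.\<close>

definition v_factor :: "nat \<Rightarrow> nat list \<Rightarrow> nat \<Rightarrow> 'k::comm_ring_1 mpoly" where
  "v_factor p lam k =
     (let low = Max (fst ` antidiagonal p lam k); high = Min (fst ` antidiagonal p lam k)
      in bracket (map (\<lambda>a. (high + a, p ^ a)) [0..<low - high + 1]))"

definition v_poly :: "nat \<Rightarrow> nat list \<Rightarrow> 'k::comm_ring_1 mpoly" where
  "v_poly p lam = (\<Prod>k=1..part (T_conjugate p lam) 1. v_factor p lam k)"

text \<open>
  The library order on \<open>nat \<Rightarrow>\<^sub>0 nat\<close> is left lexicographic: \<open>d < e\<close> iff \<open>d k < e k\<close> at the first
  index \<open>k\<close> where \<open>d\<close> and \<open>e\<close> differ.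
\<close>

definition leading_monomial :: "'k::zero_neq_one mpoly \<Rightarrow> 'k mpoly" where
  "leading_monomial f = Poly_Mapping.single (Max (Poly_Mapping.keys f)) 1"

definition s_poly :: "nat \<Rightarrow> nat list \<Rightarrow> 'k::comm_ring_1 mpoly" where
  "s_poly p lam = leading_monomial (v_poly p lam)"

definition p_poly :: "nat \<Rightarrow> nat list \<Rightarrow> 'k::comm_ring_1 mpoly" where
  "p_poly p lam =
     (\<Prod>j=1..num_blocks p lam. w_prod p (conj_partition (block_partition p lam j)) ^ (p ^ (j - 1)))"

end

theory Submission
  imports Defs
begin

text \<open>
  The total operation sends \<open>x\<^sub>j\<close> to \<open>x\<^sub>j + \<Sum>i\<ge>1. \<tau>\<^sub>i x\<^sub>j\<^bsup>p^i\<^esup>\<close>. Let \<open>hop\<close> be its homogenized form, in which a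
  further variable \<open>\<tau>\<^sub>0\<close> is the coefficient of \<open>x\<^sub>j\<close>. For homogeneous \<open>f\<close> nothing is lost: \<open>P(R) f\<close> is the
  coefficient of a single monomial \<open>\<tau>\<^sup>R\<close> in \<open>hop f\<close>, where the exponent of \<open>\<tau>\<^sub>0\<close> makes up the degree
  (\<open>milnor_eq_lookup_hop\<close>). For the polynomials of the theorem this exponent turns out to be the spike
  entry of the first part, or 0, so that it is of the same kind as the other exponents
  \<open>R\<^sub>u = (b + 1) p\<^sup>a - 1\<close>. All digits of such a number below the top one are \<open>p - 1\<close>.

  A coefficient at \<open>\<tau>\<^sup>R\<close> can be computed modulo the ideal \<open>null R\<close> of those polynomials all of whose
  multiples have coefficient 0 at \<open>\<tau>\<^sup>R\<close>. It contains \<open>\<tau>\<^sub>u\<^bsup>e\<^esup>\<close> for \<open>e > R\<^sub>u\<close>, so that a variable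
  disappears from the later factors of a product once the earlier ones have used it up.

  Part (i) for \<open>s(\<lambda>)\<close>. The exponent of \<open>x\<^sub>i\<close> in \<open>s(\<lambda>)\<close> is the spike entry of \<open>\<lambda>\<^sub>i\<close>. Sorting by digits, \<open>hop s(\<lambda>)\<close>
  is a product over the levels \<open>c\<close> of products of the linear forms \<open>\<Sum>u. \<tau>\<^sub>u\<^bsup>p^c\<^esup> x\<^sub>i\<^bsup>p^(c+u)\<^esup>\<close>, and
  T-regularity says that on each level the exponents are \<open>p - 1, \<dots>, p - 1, b, 0, \<dots>, 0\<close>. The \<open>p\<close>th power of
  such a form is a combination of \<open>p\<close>th powers of the \<open>\<tau>\<^sub>u\<^bsup>p^c\<^esup>\<close> and vanishes modulo the ideal once the
  higher digits have been used up. So in the presence of the earlier forms the last one may be changed by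
  multiples of them, and elimination turns it into a quotient of two consecutive leading minors times one
  variable (\<open>prod_linear_forms_mod_ideal\<close>). These minors are Moore determinants \<open>w(k)\<close>, and the product over
  the levels, from the highest down, is \<open>p(\<lambda>')\<close> (\<open>staircase_product_mod_null\<close>).

  Part (i) for \<open>v(\<lambda>)\<close>. The exponent of \<open>x\<^sub>i\<close> in any monomial of \<open>v(\<lambda>)\<close> is a sum of \<open>\<lambda>\<^sub>i\<close> powers of \<open>p\<close>, one for
  each antidiagonal through row \<open>i\<close>, so its digit sum is at most \<open>\<lambda>\<^sub>i\<close>. But the image of a monomial
  under \<open>hop\<close> involves only exponent vectors whose total digit sum is at most that of the monomial, and the
  digit sum of \<open>R\<close> is \<open>\<Sum>i. \<lambda>\<^sub>i\<close> (\<open>weight_le_of_lookup_hop\<close>). In a surviving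
  monomial every exponent therefore has digit sum \<open>\<lambda>\<^sub>i\<close>; the spike entry is the least number with this digit
  sum, and the degree leaves only \<open>s(\<lambda>)\<close> (\<open>eq_spike_key_of_weight_ge\<close>). Its coefficient is a product of the
  signs \<open>(-1)\<^bsup>s div 2\<^esup>\<close> of the reversals of \<open>s\<close> letters, one for each antidiagonal of length \<open>s\<close>; since
  \<open>\<gamma>\<^sub>c\<close> counts the antidiagonals of length at least \<open>c\<close>, this product is \<open>(-1)\<^bsup>\<epsilon>(\<lambda>)\<^esup>\<close> (\<open>sign_eq\<close>).

  Part (ii). Here \<open>w(\<lambda>')\<close> is the product of the \<open>w(k\<^sub>c)\<^bsup>p-1\<^esup>\<close> with \<open>k\<^sub>0 > k\<^sub>1 > \<dots>\<close>. Because the sizes decrease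
  strictly, the matrix of \<open>hop w(k\<^sub>0)\<close> is modulo \<open>null R\<close> an upper triangular matrix with diagonal
  \<open>\<tau>\<^sub>0, \<tau>\<^sub>0\<^bsup>p\<^esup>, \<tau>\<^sub>0\<^bsup>p^2\<^esup>, \<dots>\<close> times the Moore matrix. The \<open>(p-1)\<close>st power of the determinant has
  exactly the exponent of \<open>\<tau>\<^sub>0\<close> that \<open>R\<close> allows; hence \<open>\<tau>\<^sub>0\<close> may be put to 0 in the next factor, where \<open>\<tau>\<^sub>1\<close> takes
  its place, and so on (\<open>hop_w_powers_mod_null\<close>).

  Part (iii) is the same computation with all spike entries moved up by one place and exponent 0 at \<open>\<tau>\<^sub>0\<close>.
  Each \<open>x\<^sub>i\<^bsup>p^u\<^esup>\<close> is replaced by its \<open>p\<close>th power, and so is the result. The parameter \<open>h \<in> {0, 1}\<close> below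
  stands for this shift.
\<close>

section \<open>Products of linear forms modulo an ideal\<close>

definition ring_ideal :: "'a::comm_ring_1 set \<Rightarrow> bool" where
  "ring_ideal I \<longleftrightarrow> 0 \<in> I \<and> (\<forall>a\<in>I. \<forall>b\<in>I. a + b \<in> I) \<and> (\<forall>a\<in>I. \<forall>r. r * a \<in> I)"

lemma ring_idealD:
  assumes "ring_ideal I"
  shows "0 \<in> I" "a \<in> I \<Longrightarrow> b \<in> I \<Longrightarrow> a + b \<in> I" "a \<in> I \<Longrightarrow> r * a \<in> I" "a \<in> I \<Longrightarrow> a * r \<in> I"
  using assms by (auto simp: ring_ideal_def mult.commute)

lemma ring_ideal_minus:
  assumes "ring_ideal I" "a \<in> I" "b \<in> I"
  shows "a - b \<in> I"
  using ring_idealD(2)[OF assms(1,2) ring_idealD(3)[OF assms(1,3), of "-1"]] by simp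

lemma ring_ideal_sum:
  assumes "ring_ideal I" "\<And>x. x \<in> A \<Longrightarrow> f x \<in> I"
  shows "sum f A \<in> I"
  using assms(2) by (induction A rule: infinite_finite_induct) (auto intro: ring_idealD[OF assms(1)])

lemma ring_ideal_diff_trans:
  assumes "ring_ideal I" "a - b \<in> I" "b - c \<in> I"
  shows "a - c \<in> I"
  using ring_idealD(2)[OF assms] by simp

lemma ring_ideal_diff_power:
  assumes "ring_ideal I" "(x - y) * z \<in> I"
  shows "(x ^ k - y ^ k) * z \<in> I"
proof (induction k)
  case 0
  then show ?case by (simp add: ring_idealD[OF assms(1)])
next
  case (Suc k)
  have "(x ^ Suc k - y ^ Suc k) * z = x ^ k * ((x - y) * z) + y * ((x ^ k - y ^ k) * z)"
    by (simp add: algebra_simps)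
  then show ?case using Suc assms by (auto intro: ring_idealD[OF assms(1)])
qed

lemma ring_ideal_colon: "ring_ideal I \<Longrightarrow> ring_ideal {x. x * z \<in> I}"
  unfolding ring_ideal_def by (auto simp: distrib_right mult.assoc)

lemma ring_ideal_diff_sum:
  assumes "ring_ideal I" "finite A" "finite B"
    and "\<And>u. u \<in> A \<Longrightarrow> u \<notin> B \<Longrightarrow> g u \<in> I" "\<And>u. u \<in> B \<Longrightarrow> u \<notin> A \<Longrightarrow> g u \<in> I"
  shows "sum g A - sum g B \<in> I"
proof -
  have "sum g A = sum g (A - B) + sum g (A \<inter> B)" "sum g B = sum g (B - A) + sum g (A \<inter> B)"
    using assms(2,3) by (metis sum.Int_Diff Int_commute add.commute)+
  then have "sum g A - sum g B = sum g (A - B) - sum g (B - A)" by simp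
  also have "\<dots> \<in> I"
    using assms by (intro ring_ideal_minus ring_ideal_sum) auto
  finally show ?thesis .
qed

lemma ring_ideal_diff_mult:
  assumes "ring_ideal I" "a - b \<in> I" "c - d \<in> I"
  shows "a * c - b * d \<in> I"
proof -
  have "a * c - b * d = (a - b) * c + b * (c - d)" by (simp add: algebra_simps)
  then show ?thesis
    using ring_idealD(2)[OF assms(1) ring_idealD(4)[OF assms(1,2)] ring_idealD(3)[OF assms(1,3)]] by simp
qed

lemma ring_ideal_diff_prod:
  assumes "ring_ideal I" "\<And>x. x \<in> A \<Longrightarrow> f x - g x \<in> I"
  shows "prod f A - prod g A \<in> I"
  using assms(2)
  by (induction A rule: infinite_finite_induct)
    (auto intro!: ring_ideal_diff_mult ring_idealD(1) assms(1))

lemma ring_ideal_diff_det: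
  assumes I: "ring_ideal I" and A: "A \<in> carrier_mat n n" and B: "B \<in> carrier_mat n n"
    and entries: "\<And>i j. i < n \<Longrightarrow> j < n \<Longrightarrow> A $$ (i, j) - B $$ (i, j) \<in> I"
  shows "det A - det B \<in> I"
proof -
  have "det A - det B = (\<Sum>\<pi>\<in>{\<pi>. \<pi> permutes {0..<n}}.
      signof \<pi> * ((\<Prod>i=0..<n. A $$ (i, \<pi> i)) - (\<Prod>i=0..<n. B $$ (i, \<pi> i))))"
    unfolding det_def'[OF A] det_def'[OF B] by (simp add: sum_subtractf right_diff_distrib)
  also have "\<dots> \<in> I"
    by (rule ring_ideal_sum[OF I], rule ring_idealD(3)[OF I], rule ring_ideal_diff_prod[OF I])
      (auto intro!: entries dest: permutes_in_image)
  finally show ?thesis .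
qed

definition minor :: "(nat \<Rightarrow> nat \<Rightarrow> 'a::comm_ring_1) \<Rightarrow> nat \<Rightarrow> 'a" where
  "minor m k = det (mat k k (\<lambda>(i, u). m i u))"

lemma minor_0 [simp]: "minor m 0 = 1"
  by (simp add: minor_def)

text \<open>
  The cofactors along the last column of the leading minor of size \<open>g + 1\<close>.
\<close>

lemma minor_column_relation:
  fixes m :: "nat \<Rightarrow> nat \<Rightarrow> 'a::comm_ring_1"
  obtains c where "c g = minor m g" "\<And>u. u < g \<Longrightarrow> (\<Sum>i<Suc g. c i * m i u) = 0"
    "(\<Sum>i<Suc g. c i * m i g) = minor m (Suc g)"
proof -
  define M where "M = mat (Suc g) (Suc g) (\<lambda>(i, u). m i u)"
  define c where "c i = cofactor M i g" for i
  have M: "M \<in> carrier_mat (Suc g) (Suc g)" by (simp add: M_def)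
  have "mat_delete M g g = mat g g (\<lambda>(i, u). m i u)"
    unfolding mat_delete_def M_def by (rule eq_matI) auto
  then have 1: "c g = minor m g"
    by (simp add: c_def cofactor_def minor_def flip: mult_2)
  have *: "(\<Sum>i<Suc g. c i * m i u) = (adj_mat M * M) $$ (g, u)" if "u \<le> g" for u
    using that M by (auto simp: adj_mat_def c_def scalar_prod_def M_def times_mat_def atLeast0LessThan intro!: sum.cong)
  have 2: "(\<Sum>i<Suc g. c i * m i u) = 0" if "u < g" for u
    using that by (subst *) (auto simp: adj_mat(3)[OF M])
  have 3: "(\<Sum>i<Suc g. c i * m i g) = minor m (Suc g)"
    by (subst *) (auto simp: adj_mat(3)[OF M] minor_def simp flip: M_def)
  show thesis by (rule that[OF 1 2 3])
qed

text \<open>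
  Elimination: the cofactor relation combines the first \<open>g + 1\<close> forms so that the variables before
  \<open>y g\<close> cancel. Modulo the ideal of all \<open>x\<close> with \<open>x * z \<in> I\<close>, which contains the first \<open>g\<close> forms and the
  variables after \<open>y g\<close>, only the last form and \<open>y g\<close> are left.
\<close>

lemma linear_form_reduction:
  fixes m :: "nat \<Rightarrow> nat \<Rightarrow> 'a::comm_ring_1" and y :: "nat \<Rightarrow> 'a"
    and n :: nat
  defines "l \<equiv> \<lambda>i. \<Sum>u<n. y u * m i u"
  assumes I: "ring_ideal I" and g: "g < n"
    and li: "\<And>i. i < g \<Longrightarrow> l i * z \<in> I" and yu: "\<And>u. g < u \<Longrightarrow> u < n \<Longrightarrow> y u * z \<in> I"
  shows "(minor m g * l g - minor m (Suc g) * y g) * z \<in> I"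
proof -
  obtain c where c: "c g = minor m g" "\<And>u. u < g \<Longrightarrow> (\<Sum>i<Suc g. c i * m i u) = 0"
    "(\<Sum>i<Suc g. c i * m i g) = minor m (Suc g)"
    by (rule minor_column_relation[of g m]) blast
  have "(\<Sum>i<Suc g. c i * l i) = (\<Sum>u<n. y u * (\<Sum>i<Suc g. c i * m i u))"
    unfolding l_def sum_distrib_left by (subst sum.swap) (simp add: mult_ac)
  also have "\<dots> = (\<Sum>u\<in>{..<g} \<union> {g} \<union> {g<..<n}. y u * (\<Sum>i<Suc g. c i * m i u))"
    using g by (intro sum.cong) auto
  also have "\<dots> = y g * minor m (Suc g) + (\<Sum>u\<in>{g<..<n}. y u * (\<Sum>i<Suc g. c i * m i u))"
    using c by (subst sum.union_disjoint, auto simp: sum.union_disjoint simp del: sum.lessThan_Suc)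
  finally have "minor m g * l g - minor m (Suc g) * y g
      = (\<Sum>u\<in>{g<..<n}. y u * (\<Sum>i<Suc g. c i * m i u)) - (\<Sum>i<g. c i * l i)"
    using c(1) by (simp add: algebra_simps)
  then have "(minor m g * l g - minor m (Suc g) * y g) * z
      = (\<Sum>u\<in>{g<..<n}. (\<Sum>i<Suc g. c i * m i u) * (y u * z)) - (\<Sum>i<g. c i * (l i * z))"
    by (simp only: left_diff_distrib right_diff_distrib sum_distrib_left sum_distrib_right mult_ac)
  also have "\<dots> \<in> I"
    by (rule ring_ideal_minus[OF I]; rule ring_ideal_sum[OF I]; rule ring_idealD(3)[OF I])
      (auto intro: li yu)
  finally show ?thesis .
qed

text \<open>
  The forms with exponent \<open>p - 1\<close> annihilate their own product, because their \<open>p\<close>th powers lie in the ideal.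
  So in the last factor \<open>l f\<close> can be traded for \<open>minor m (Suc f) / minor m f * y f\<close>; the division is
  allowed because minors can be cancelled. What remains is the same product with \<open>f - 1\<close> and \<open>b = p - 1\<close>,
  relative to \<open>y f ^ b * Y\<close> in place of \<open>Y\<close>; this is why \<open>Y\<close> varies in the induction.
\<close>

lemma prod_linear_forms_mod_ideal:
  fixes m :: "nat \<Rightarrow> nat \<Rightarrow> 'a::comm_ring_1" and y :: "nat \<Rightarrow> 'a"
    and n :: nat
  defines "l \<equiv> \<lambda>i. \<Sum>u<n. y u * m i u"
  assumes p: "prime p" "CHAR('a) = p" and I: "ring_ideal I"
    and cancel: "\<And>j x. j < n \<Longrightarrow> minor m j * x \<in> I \<Longrightarrow> x \<in> I"
    and "f < n" "b \<le> p - 1" "\<And>u. u < f \<Longrightarrow> y u ^ p * Y \<in> I" "y f ^ Suc b * Y \<in> I"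
      "\<And>u. f < u \<Longrightarrow> u < n \<Longrightarrow> y u * Y \<in> I"
  shows "((\<Prod>i<f. l i ^ (p - 1)) * l f ^ b
    - minor m (Suc f) ^ b * minor m f ^ (p - 1 - b) * ((\<Prod>u<f. y u ^ (p - 1)) * y f ^ b)) * Y \<in> I"
  using assms(6-)
proof (induction f arbitrary: b Y)
  case 0
  have "(minor m 0 * l 0 - minor m (Suc 0) * y 0) * Y \<in> I"
    unfolding l_def by (rule linear_form_reduction[OF I]) (use 0 in auto)
  from ring_ideal_diff_power[OF I this, of b] show ?case
    by (simp add: power_mult_distrib)
next
  case (Suc f)
  define g where "g = Suc f"
  define A where "A = (\<Prod>i<g. l i ^ (p - 1))"
  have p1: "p = Suc (p - 1)" using prime_gt_0_nat[OF p(1)] by simp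
  have yp: "y u ^ p * Y \<in> I" if "u < n" for u
  proof -
    consider "u < g" | "u = g" | "u > g" by linarith
    then show ?thesis
    proof cases
      case 2
      have "y u ^ p * Y = y u ^ (p - Suc b) * (y (Suc f) ^ Suc b * Y)"
        using Suc.prems(2) p1 2 by (simp add: g_def flip: power_add mult.assoc power_Suc)
      then show ?thesis using ring_idealD(3)[OF I Suc.prems(4)] by simp
    next
      case 3
      have "y u ^ p * Y = y u ^ (p - 1) * (y u * Y)"
        by (subst p1) (simp add: mult_ac)
      then show ?thesis using ring_idealD(3)[OF I Suc.prems(5)] 3 that by (simp add: g_def)
    qed (use Suc.prems(3) in \<open>simp add: g_def\<close>)
  qed
  have lp: "l i ^ p * Y \<in> I" for i
  proof -
    have "l i ^ p * Y = (\<Sum>u<n. m i u ^ p * (y u ^ p * Y))"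
      using p unfolding l_def
      by (subst freshmans_dream_sum) (auto simp: power_mult_distrib sum_distrib_left mult_ac)
    also have "\<dots> \<in> I"
      by (rule ring_ideal_sum[OF I], rule ring_idealD(3)[OF I]) (auto intro: yp)
    finally show ?thesis .
  qed
  have lA: "l i * (A * Y) \<in> I" if "i < g" for i
  proof -
    have "A = l i ^ (p - 1) * (\<Prod>j\<in>{..<g} - {i}. l j ^ (p - 1))"
      unfolding A_def using that by (subst prod.remove[of _ i]) auto
    then have "l i * (A * Y) = (\<Prod>j\<in>{..<g} - {i}. l j ^ (p - 1)) * (l i ^ Suc (p - 1) * Y)"
      by (simp add: mult_ac)
    also have "\<dots> \<in> I"
      unfolding p1[symmetric] by (rule ring_idealD(3)[OF I lp])
    finally show ?thesis .
  qed
  have "(minor m g * l g - minor m (Suc g) * y g) * (A * Y) \<in> I"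
    unfolding l_def
  proof (rule linear_form_reduction[OF I])
    show "g < n" using Suc.prems g_def by simp
    show "(\<Sum>u<n. y u * m i u) * (A * Y) \<in> I" if "i < g" for i
      using lA[OF that] by (simp add: l_def)
    show "y u * (A * Y) \<in> I" if "g < u" "u < n" for u
      using ring_idealD(3)[OF I Suc.prems(5), of u A] that by (simp add: g_def mult_ac)
  qed
  from ring_ideal_diff_power[OF I this, of b]
  have 1: "minor m g ^ b * (A * l g ^ b * Y) - minor m (Suc g) ^ b * (A * (y g ^ b * Y)) \<in> I"
    by (simp add: power_mult_distrib algebra_simps)
  have "((\<Prod>i<f. l i ^ (p - 1)) * l f ^ (p - 1)
    - minor m (Suc f) ^ (p - 1) * minor m f ^ (p - 1 - (p - 1)) * ((\<Prod>u<f. y u ^ (p - 1)) * y f ^ (p - 1)))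
     * (y g ^ b * Y) \<in> I"
  proof (rule Suc.IH)
    show "y u ^ p * (y g ^ b * Y) \<in> I" if "u < f" for u
      using ring_idealD(3)[OF I yp, of u "y g ^ b"] that Suc.prems(1) by (simp add: mult_ac)
    show "y f ^ Suc (p - 1) * (y g ^ b * Y) \<in> I"
      using ring_idealD(3)[OF I yp, of f "y g ^ b"] Suc.prems(1)
      unfolding p1[symmetric] by (simp add: mult_ac)
    show "y u * (y g ^ b * Y) \<in> I" if "f < u" "u < n" for u
    proof (cases "u = g")
      case True
      then show ?thesis using Suc.prems(4) by (simp add: g_def mult_ac)
    next
      case False
      then show ?thesis
        using ring_idealD(3)[OF I Suc.prems(5), of u "y g ^ b"] that by (simp add: g_def mult_ac)
    qed
  qed (use Suc.prems in auto)
  from ring_idealD(3)[OF I this, of "minor m (Suc g) ^ b"]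
  have 2: "minor m (Suc g) ^ b * (A * (y g ^ b * Y))
      - minor m (Suc g) ^ b * (minor m g ^ (p - 1) * (\<Prod>u<g. y u ^ (p - 1)) * (y g ^ b * Y)) \<in> I"
    by (simp add: A_def g_def algebra_simps)
  \<comment> \<open>The elimination step introduced the factor \<open>minor m g ^ b\<close>.\<close>
  have cancel_power: "minor m g ^ k * x \<in> I \<Longrightarrow> x \<in> I" for k x
    using Suc.prems(1) by (induction k) (auto simp: mult.assoc g_def intro: cancel)
  have "minor m g ^ (p - 1) = minor m g ^ b * minor m g ^ (p - 1 - b)"
    using Suc.prems(2) by (metis le_add_diff_inverse power_add)
  with ring_ideal_diff_trans[OF I 1 2]
  have "minor m g ^ b * ((A * l g ^ b - minor m (Suc g) ^ b * minor m g ^ (p - 1 - b) *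
     ((\<Prod>u<g. y u ^ (p - 1)) * y g ^ b)) * Y) \<in> I"
    by (simp add: algebra_simps)
  from cancel_power[OF this] show ?case
    by (simp add: A_def g_def)
qed

section \<open>Polynomials: constants, null ideals, substitution homomorphisms\<close>

abbreviation "lookup \<equiv> Poly_Mapping.lookup"
abbreviation "keys \<equiv> Poly_Mapping.keys"
abbreviation "single \<equiv> Poly_Mapping.single"

lemma cst_0 [simp]: "cst 0 = 0"
  and cst_1 [simp]: "cst 1 = (1 :: 'a::comm_ring_1 mpoly)"
  and cst_add: "cst (a + b) = cst a + (cst b :: 'a mpoly)"
  and cst_mult: "cst (a * b) = cst a * (cst b :: 'a mpoly)"
  by (simp_all add: cst_def single_add mult_single)

lemma comm_ring_hom_cst: "comm_ring_hom (cst :: 'a::comm_ring_1 \<Rightarrow> 'a mpoly)"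
  by standard (simp_all add: cst_add cst_mult)

interpretation cst: comm_ring_hom "cst :: 'a::comm_ring_1 \<Rightarrow> 'a mpoly"
  by (rule comm_ring_hom_cst)

lemma lookup_cst_mult: "lookup (cst c * f) e = c * lookup f e" for c :: "'a::comm_ring_1"
proof -
  have "cst c * f = Poly_Mapping.map ((*) c) f"
    by (simp add: mult_map_scale_conv_mult cst_def)
  then show ?thesis by (simp add: Poly_Mapping.map.rep_eq when_def)
qed

lemma cst_mult_single: "cst c * single e d = single e (c * d)" for c :: "'a::comm_ring_1"
  by (simp add: cst_def mult_single)

lemma var_power: "var i ^ n = single (single i n) (1 :: 'a::comm_ring_1)"
  by (induction n) (simp_all add: var_def mult_single flip: single_add)

lemma prod_single: "(\<Prod>i\<in>A. single (e i) (1 :: 'a::comm_ring_1)) = single (\<Sum>i\<in>A. e i :: nat \<Rightarrow>\<^sub>0 nat) 1"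
  by (induction A rule: infinite_finite_induct) (simp_all add: mult_single)

lemma CHAR_mpoly: "CHAR('a::comm_ring_1 mpoly) = CHAR('a)"
proof (rule CHAR_eqI)
  show "CHAR('a) dvd x" if "of_nat x = (0 :: 'a mpoly)" for x
    using arg_cong[OF that, of "\<lambda>f. lookup f 0"]
    by (simp add: lookup_of_nat of_nat_eq_0_iff_char_dvd)
qed (simp flip: single_of_nat)

lemma CHAR_finite_prime_field:
  assumes "prime p" "card (UNIV :: 'k::field set) = p"
  shows "CHAR('k) = p"
proof -
  have "finite (UNIV :: 'k set)"
    using assms prime_gt_0_nat[of p] by (auto intro: card_ge_0_finite)
  then have "(\<Sum>x\<in>UNIV. x + 1 :: 'k) = (\<Sum>x\<in>UNIV. x)"
    by (intro sum.reindex_bij_witness[of _ "\<lambda>x. x - 1" "\<lambda>x. x + 1"]) auto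
  then have "of_nat p = (0 :: 'k)"
    by (simp add: sum.distrib assms)
  then have "CHAR('k) dvd p"
    by (simp add: of_nat_eq_0_iff_char_dvd)
  then show ?thesis
    using assms(1) by (auto simp: prime_nat_iff)
qed

lemma mpoly_sum_monomials: "f = (\<Sum>e\<in>keys f. single e (lookup f e))"
  by (rule poly_mapping_eqI) (auto simp: lookup_sum lookup_single when_def sum.delta in_keys_iff)

text \<open>
  The largest ideal all of whose elements have coefficient 0 at \<open>R\<close>.
\<close>

definition null :: "(nat \<Rightarrow>\<^sub>0 nat) \<Rightarrow> 'a::comm_ring_1 mpoly set" where
  "null R = {f. \<forall>H. lookup (H * f) R = 0}"

lemma ring_ideal_null: "ring_ideal (null R)"
  unfolding ring_ideal_def null_def
proof (intro conjI ballI allI)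
  fix a b r :: "'a mpoly" assume a: "a \<in> {f. \<forall>H. lookup (H * f) R = 0}"
  show "r * a \<in> {f. \<forall>H. lookup (H * f) R = 0}"
    using a by (simp flip: mult.assoc)
  assume "b \<in> {f. \<forall>H. lookup (H * f) R = 0}"
  then show "a + b \<in> {f. \<forall>H. lookup (H * f) R = 0}"
    using a by (simp add: distrib_left lookup_add)
qed simp

lemma single_in_null:
  assumes "lookup R u < lookup e u"
  shows "single e c \<in> null R"
proof -
  have "lookup (H * single e c) R = 0" for H
  proof (rule ccontr)
    assume "lookup (H * single e c) R \<noteq> 0"
    then obtain d e' where "R = d + e'" "e' \<in> keys (single e c)"
      using keys_mult[of H "single e c"] by (auto simp flip: in_keys_iff)
    then show False using assms by (auto simp: lookup_add split: if_splits)
  qed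
  then show ?thesis by (simp add: null_def)
qed

lemma var_power_in_null: "lookup R u < n \<Longrightarrow> var u ^ n \<in> null R"
  unfolding var_power by (rule single_in_null[of _ u]) simp

text \<open>
  Nonzero constants act injectively on coefficients; this is the cancellation of minors needed for the
  elimination of linear forms.
\<close>

lemma null_cancel_cst:
  fixes c :: "'a::idom"
  assumes "cst c * f \<in> null R" "c \<noteq> 0"
  shows "f \<in> null R"
proof -
  have "c * lookup (H * f) R = 0" for H
    using assms(1) by (auto simp: null_def mult.left_commute[of _ "cst c"] lookup_cst_mult)
  then show ?thesis using assms(2) by (auto simp: null_def)
qed

lemma lookup_eq_of_null:
  fixes f :: "'a::comm_ring_1 mpoly"
  assumes "f - g \<in> null R"
  shows "lookup f R = lookup g R"
  using assms by (auto simp: null_def lookup_minus dest: spec[of _ 1])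

definition monom_eval :: "(nat \<Rightarrow> 'b::comm_ring_1) \<Rightarrow> (nat \<Rightarrow>\<^sub>0 nat) \<Rightarrow> 'b" where
  "monom_eval \<phi> e = (\<Prod>j\<in>keys e. \<phi> j ^ lookup e j)"

lemma monom_eval_superset:
  "finite A \<Longrightarrow> keys e \<subseteq> A \<Longrightarrow> monom_eval \<phi> e = (\<Prod>j\<in>A. \<phi> j ^ lookup e j)"
  unfolding monom_eval_def by (rule prod.mono_neutral_left) (auto simp: in_keys_iff)

lemma monom_eval_0 [simp]: "monom_eval \<phi> 0 = 1"
  by (simp add: monom_eval_def)

lemma monom_eval_add: "monom_eval \<phi> (d + e) = monom_eval \<phi> d * monom_eval \<phi> e"
proof -
  have "keys (d + e) \<subseteq> keys d \<union> keys e" by (rule keys_add)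
  then show ?thesis
    using monom_eval_superset[of "keys d \<union> keys e" "d + e" \<phi>]
      monom_eval_superset[of "keys d \<union> keys e" d \<phi>] monom_eval_superset[of "keys d \<union> keys e" e \<phi>]
    by (simp add: lookup_add power_add prod.distrib)
qed

lemma monom_eval_single [simp]: "monom_eval \<phi> (single j n) = \<phi> j ^ n"
  by (simp add: monom_eval_def)

definition lift :: "('a::comm_ring_1 \<Rightarrow> 'b::comm_ring_1) \<Rightarrow> (nat \<Rightarrow> 'b) \<Rightarrow> 'a mpoly \<Rightarrow> 'b" where
  "lift \<iota> \<phi> f = (\<Sum>e\<in>keys f. \<iota> (lookup f e) * monom_eval \<phi> e)"

lemma
  assumes "comm_ring_hom \<iota>"
  shows lift_single: "lift \<iota> \<phi> (single e c) = \<iota> c * monom_eval \<phi> e"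
    and comm_ring_hom_lift: "comm_ring_hom (lift \<iota> \<phi>)"
proof -
  interpret comm_ring_hom \<iota> by fact
  have superset: "lift \<iota> \<phi> f = (\<Sum>e\<in>A. \<iota> (lookup f e) * monom_eval \<phi> e)"
    if "finite A" "keys f \<subseteq> A" for A f
    unfolding lift_def using that by (intro sum.mono_neutral_left) (auto simp: in_keys_iff)
  have single: "lift \<iota> \<phi> (single e c) = \<iota> c * monom_eval \<phi> e" for e c
    by (simp add: lift_def)
  then show "lift \<iota> \<phi> (single e c) = \<iota> c * monom_eval \<phi> e" .
  have add: "lift \<iota> \<phi> (f + g) = lift \<iota> \<phi> f + lift \<iota> \<phi> g" for f g
  proof -
    have "keys (f + g) \<subseteq> keys f \<union> keys g" by (rule keys_add)
    then show ?thesis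
      using superset[of "keys f \<union> keys g" f] superset[of "keys f \<union> keys g" g]
        superset[of "keys f \<union> keys g" "f + g"]
      by (simp add: lookup_add hom_add algebra_simps sum.distrib)
  qed
  have zero: "lift \<iota> \<phi> 0 = 0" by (simp add: lift_def)
  have sum: "lift \<iota> \<phi> (sum f A) = (\<Sum>x\<in>A. lift \<iota> \<phi> (f x))" for f and A :: "(nat \<Rightarrow>\<^sub>0 nat) set"
    by (induction A rule: infinite_finite_induct) (simp_all add: add zero)
  have mult: "lift \<iota> \<phi> (f * g) = lift \<iota> \<phi> f * lift \<iota> \<phi> g" for f g
  proof -
    have "f * g = (\<Sum>d\<in>keys f. \<Sum>e\<in>keys g. single (d + e) (lookup f d * lookup g e))"
      by (subst (1) mpoly_sum_monomials[of f], subst (1) mpoly_sum_monomials[of g])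
        (simp add: sum_product mult_single)
    then have "lift \<iota> \<phi> (f * g) = (\<Sum>d\<in>keys f. \<Sum>e\<in>keys g.
        (\<iota> (lookup f d) * monom_eval \<phi> d) * (\<iota> (lookup g e) * monom_eval \<phi> e))"
      by (simp add: sum single hom_mult monom_eval_add mult_ac)
    then show ?thesis by (simp add: lift_def sum_product)
  qed
  show "comm_ring_hom (lift \<iota> \<phi>)"
    by standard (simp_all add: add zero mult single flip: single_one)
qed

subsection \<open>Families of monomials that multiply\<close>

text \<open>
  Degrees, supports and digit sums are all controlled in the same way: a set of monomials is attached to
  every number, and products of monomials respect addition. This transfers to polynomials built from
  such monomials.
\<close>

definition additive_family :: "(nat \<Rightarrow> (nat \<Rightarrow>\<^sub>0 nat) \<Rightarrow> bool) \<Rightarrow> bool" where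
  "additive_family P \<longleftrightarrow> P 0 0 \<and> (\<forall>a b d e. P a d \<longrightarrow> P b e \<longrightarrow> P (a + b) (d + e))"

definition graded :: "(nat \<Rightarrow> (nat \<Rightarrow>\<^sub>0 nat) \<Rightarrow> bool) \<Rightarrow> nat \<Rightarrow> 'a::comm_ring_1 mpoly \<Rightarrow> bool" where
  "graded P n f \<longleftrightarrow> (\<forall>e\<in>keys f. P n e)"

lemma graded_0 [simp]: "graded P n 0"
  by (simp add: graded_def)

lemma graded_single: "P n e \<Longrightarrow> graded P n (single e c)"
  by (simp add: graded_def)

lemma graded_add: "graded P n f \<Longrightarrow> graded P n g \<Longrightarrow> graded P n (f + g)"
  unfolding graded_def using keys_add[of f g] by blast

lemma graded_sum: "(\<And>x. x \<in> A \<Longrightarrow> graded P n (f x)) \<Longrightarrow> graded P n (sum f A)"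
  by (induction A rule: infinite_finite_induct) (simp_all add: graded_add)

lemma graded_mult:
  assumes "additive_family P" "graded P a f" "graded P b g"
  shows "graded P (a + b) (f * g)"
  unfolding graded_def
proof
  fix e assume "e \<in> keys (f * g)"
  then obtain d d' where "d \<in> keys f" "d' \<in> keys g" "e = d + d'"
    using keys_mult[of f g] by auto
  then show "P (a + b) e" using assms by (auto simp: additive_family_def graded_def)
qed

lemma graded_cst: "additive_family P \<Longrightarrow> graded P 0 (cst c)"
  by (simp add: additive_family_def graded_def cst_def)

lemma graded_cst_mult: "additive_family P \<Longrightarrow> graded P n f \<Longrightarrow> graded P n (cst c * f)"
  using graded_mult[OF _ graded_cst, of P n f] by simp

lemma graded_prod:
  assumes "additive_family P" "\<And>x. x \<in> A \<Longrightarrow> graded P (a x) (f x)"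
  shows "graded P (\<Sum>x\<in>A. a x) (\<Prod>x\<in>A. f x)"
  using assms(2)
proof (induction A rule: infinite_finite_induct)
  case (insert x A)
  then show ?case by (simp add: graded_mult[OF assms(1)])
qed (use graded_cst[OF assms(1), of 1] in simp_all)

lemma graded_power:
  assumes "additive_family P" "graded P a f"
  shows "graded P (n * a) (f ^ n)"
  using graded_prod[OF assms(1), of "{..<n}" "\<lambda>_. a" "\<lambda>_. f"] assms(2) by simp

definition tdeg :: "(nat \<Rightarrow>\<^sub>0 nat) \<Rightarrow> nat" where
  "tdeg e = (\<Sum>u\<in>keys e. lookup e u)"

lemma tdeg_superset: "finite A \<Longrightarrow> keys e \<subseteq> A \<Longrightarrow> tdeg e = (\<Sum>u\<in>A. lookup e u)"
  unfolding tdeg_def by (rule sum.mono_neutral_left) (auto simp: in_keys_iff)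

lemma tdeg_0 [simp]: "tdeg 0 = 0"
  by (simp add: tdeg_def)

lemma tdeg_single [simp]: "tdeg (single i n) = n"
  by (simp add: tdeg_def)

lemma tdeg_add [simp]: "tdeg (d + e) = tdeg d + tdeg e"
proof -
  have "keys (d + e) \<subseteq> keys d \<union> keys e" by (rule keys_add)
  then show ?thesis
    using tdeg_superset[of "keys d \<union> keys e" "d + e"]
      tdeg_superset[of "keys d \<union> keys e" d] tdeg_superset[of "keys d \<union> keys e" e]
    by (simp add: lookup_add sum.distrib)
qed

lemma tdeg_sum: "tdeg (\<Sum>x\<in>A. f x) = (\<Sum>x\<in>A. tdeg (f x))"
  by (induction A rule: infinite_finite_induct) simp_all

definition homog :: "nat \<Rightarrow> 'a::comm_ring_1 mpoly \<Rightarrow> bool" where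
  "homog = graded (\<lambda>n e. tdeg e = n)"

lemma additive_family_tdeg: "additive_family (\<lambda>n e. tdeg e = n)"
  by (simp add: additive_family_def)

lemmas homog_prod = graded_prod[OF additive_family_tdeg, folded homog_def]
  and homog_power = graded_power[OF additive_family_tdeg, folded homog_def]
  and homog_cst_mult = graded_cst_mult[OF additive_family_tdeg, folded homog_def]
  and homog_sum = graded_sum[of _ "\<lambda>n e. tdeg e = n", folded homog_def]

lemma homog_var_power: "homog n (var i ^ n)"
  by (simp add: homog_def graded_single var_power)

section \<open>The homogenized total operation\<close>

text \<open>
  The sum starts at \<open>u = 0\<close>: this is the total operation, homogenized by \<open>var 0\<close>.
\<close>

definition hop :: "nat \<Rightarrow> nat \<Rightarrow> 'k::comm_ring_1 mpoly \<Rightarrow> 'k mpoly mpoly" where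
  "hop p t = lift (\<lambda>c. cst (cst c)) (\<lambda>j. \<Sum>u\<le>t. var u * cst (var j ^ (p ^ u)))"

lemma comm_ring_hom_cst_cst: "comm_ring_hom (\<lambda>c. cst (cst c :: 'k::comm_ring_1 mpoly))"
  by standard (simp_all add: cst_add cst_mult)

lemma comm_ring_hom_hop: "comm_ring_hom (hop p t)"
  unfolding hop_def by (rule comm_ring_hom_lift[OF comm_ring_hom_cst_cst])

lemma hop_single:
  "hop p t (single e c) = cst (cst c) * monom_eval (\<lambda>j. \<Sum>u\<le>t. var u * cst (var j ^ (p ^ u))) e"
  unfolding hop_def by (rule lift_single[OF comm_ring_hom_cst_cst])

lemma hop_var: "hop p t (var j) = (\<Sum>u\<le>t. var u * cst (var j ^ (p ^ u)))"
  by (subst (1) var_def, subst hop_single) simp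

lemma homog_hop_monom: "homog (tdeg e) (monom_eval (\<lambda>j. \<Sum>u\<le>t. var u * cst (var j ^ (p ^ u))) e)"
proof -
  have "homog 1 (\<Sum>u\<le>t. var u * cst (var j ^ (p ^ u)))" for j
    by (intro homog_sum, subst mult.commute, intro homog_cst_mult)
      (use homog_var_power[of 1] in simp)
  then have "homog (\<Sum>j\<in>keys e. lookup e j * 1)
     (\<Prod>j\<in>keys e. (\<Sum>u\<le>t. var u * cst (var j ^ (p ^ u))) ^ lookup e j)"
    by (intro homog_prod homog_power)
  then show ?thesis by (simp add: tdeg_def monom_eval_def)
qed

lemma homog_hop:
  assumes "homog n f"
  shows "homog n (hop p t f)"
  unfolding hop_def lift_def
proof (intro homog_sum homog_cst_mult)
  fix e assume "e \<in> keys f"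
  then have "tdeg e = n" using assms by (simp add: homog_def graded_def)
  then show "homog n (monom_eval (\<lambda>j. \<Sum>u\<le>t. var u * cst (var j ^ (p ^ u))) e)"
    using homog_hop_monom by blast
qed

text \<open>
  Setting \<open>var 0\<close> to 1 turns \<open>hop\<close> into \<open>total_op\<close>. As \<open>hop f\<close> is homogeneous of degree \<open>N\<close> in the outer
  variables, only one of its monomials specializes to the one that defines \<open>P(R)\<close>: the exponent of \<open>var 0\<close> is
  determined by the others.
\<close>

lemma milnor_eq_lookup_hop:
  fixes f :: "'k::comm_ring_1 mpoly"
  assumes f: "homog N f" and N: "(\<Sum>u\<le>length R. \<rho> u) = N"
    and \<rho>: "\<And>u. 1 \<le> u \<Longrightarrow> u \<le> length R \<Longrightarrow> \<rho> u = part R u"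
  shows "milnor p R f = lookup (hop p (length R) f) (\<Sum>u\<le>length R. single u (\<rho> u))"
proof -
  define t where "t = length R"
  \<comment> \<open>The specialization \<open>var 0 \<mapsto> 1\<close>.\<close>
  define \<psi> where "\<psi> u = (if u = 0 then 1 else var u :: 'k mpoly mpoly)" for u
  define S where "S = (\<Sum>u=1..t. single u (\<rho> u))"
  define g where "g = hop p t f"
  have g: "homog N g" unfolding g_def by (rule homog_hop[OF f])
  have split: "(\<Sum>u\<le>t. h u) = h 0 + (\<Sum>u=1..t. h u)" for h :: "nat \<Rightarrow> 'z::comm_monoid_add"
    using sum.atLeast_Suc_atMost[of 0 t h] by (simp add: atLeast0AtMost)
  interpret hop: comm_ring_hom "hop p t :: 'k mpoly \<Rightarrow> _" by (rule comm_ring_hom_hop)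
  interpret push: comm_ring_hom "lift cst \<psi> :: 'k mpoly mpoly \<Rightarrow> _"
    by (rule comm_ring_hom_lift[OF comm_ring_hom_cst])
  have push_cst: "lift cst \<psi> (cst c) = cst c" for c
    by (simp add: cst_def lift_single[OF comm_ring_hom_cst])
  have push_var: "lift cst \<psi> (var u) = \<psi> u" for u
    by (simp add: var_def lift_single[OF comm_ring_hom_cst])
  have "lift cst \<psi> (\<Sum>u\<le>t. var u * cst (var j ^ (p ^ u)))
      = cst (var j) + (\<Sum>i=1..t. var i * cst (var j ^ (p ^ i)))" for j
    by (simp add: split push.hom_add push.hom_sum push.hom_mult push_cst push_var \<psi>_def)
  then have "total_op p t f = lift cst \<psi> g"
    unfolding g_def hop_def
    by (simp add: total_op_def lift_def[of "\<lambda>c. cst (cst c)"] push.hom_sum push.hom_mult push_cst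
        monom_eval_def push.hom_prod push.hom_power)
  then have "milnor p R f = lookup (lift cst \<psi> g) S"
    by (simp add: milnor_def S_def \<rho> t_def)
  also have "\<dots> = (\<Sum>e\<in>keys g. lookup g e * lookup (monom_eval \<psi> e) S)"
    by (simp add: lift_def lookup_sum lookup_cst_mult)
  also have "\<dots> = (\<Sum>e\<in>keys g. if e = single 0 (\<rho> 0) + S then lookup g e else 0)"
  proof (rule sum.cong[OF refl])
    fix e assume "e \<in> keys g"
    then have deg: "tdeg e = N" using g by (simp add: homog_def graded_def)
    have "monom_eval \<psi> e = (\<Prod>u\<in>keys e - {0}. var u ^ lookup e u)"
      unfolding monom_eval_def by (rule prod.mono_neutral_cong_right) (auto simp: \<psi>_def)
    also have "\<dots> = single (\<Sum>u\<in>keys e - {0}. single u (lookup e u)) 1"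
      by (simp add: var_power prod_single)
    finally have m: "monom_eval \<psi> e = single (\<Sum>u\<in>keys e - {0}. single u (lookup e u)) 1" .
    define e' where "e' = (\<Sum>u\<in>keys e - {0}. single u (lookup e u))"
    have e': "lookup e' u = (if u = 0 then 0 else lookup e u)" for u
      by (auto simp: e'_def lookup_sum lookup_single when_def in_keys_iff sum.delta)
    have eq: "e = single 0 (lookup e 0) + e'"
      by (rule poly_mapping_eqI) (auto simp: lookup_add lookup_single e' when_def)
    then have dege: "lookup e 0 + tdeg e' = N"
      using deg by (metis tdeg_add tdeg_single)
    have S0: "lookup S 0 = 0"
      by (auto simp: S_def lookup_sum lookup_single when_def)
    have degS: "\<rho> 0 + tdeg S = N"
      using N by (simp add: S_def tdeg_sum split flip: t_def)
    have "e' = S \<longleftrightarrow> e = single 0 (\<rho> 0) + S"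
    proof
      assume "e' = S"
      then have "lookup e 0 = \<rho> 0" using dege degS by simp
      then show "e = single 0 (\<rho> 0) + S" using eq \<open>e' = S\<close> by metis
    next
      assume *: "e = single 0 (\<rho> 0) + S"
      show "e' = S"
        by (rule poly_mapping_eqI) (use S0 in \<open>auto simp: e' * lookup_add lookup_single when_def\<close>)
    qed
    then show "lookup g e * lookup (monom_eval \<psi> e) S = (if e = single 0 (\<rho> 0) + S then lookup g e else 0)"
      unfolding m e'_def[symmetric] by (auto simp: lookup_single when_def)
  qed
  also have "\<dots> = lookup g (single 0 (\<rho> 0) + S)"
    by (auto simp: sum.delta' in_keys_iff)
  finally show ?thesis
    by (simp add: g_def S_def split flip: t_def)
qed

section \<open>Base-p digits of Milnor spike entries\<close>

text \<open>
  \<open>spike_entry\<close> is meaningful for positive arguments only; the value 0 at 0 makes the formulas below uniform.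
\<close>

definition mspike :: "nat \<Rightarrow> nat \<Rightarrow> nat" where
  "mspike p l = (if l = 0 then 0 else spike_entry p l)"

lemma mspike_0 [simp]: "mspike p 0 = 0"
  by (simp add: mspike_def)

lemma mspike_small:
  assumes "l \<le> p - 1"
  shows "mspike p l = l"
proof (cases "l = 0")
  case False
  then have lt: "l - 1 < p - 1" using assms by linarith
  show ?thesis
    unfolding mspike_def spike_entry_def Let_def div_less[OF lt] mod_less[OF lt] using False by simp
qed simp

lemma mspike_shift:
  assumes "2 \<le> p" "0 < l"
  shows "mspike p (l + (p - 1)) = p * mspike p l + (p - 1)"
proof -
  define q where "q = p - 1"
  have q: "0 < q" "p = Suc q" using assms by (auto simp: q_def)
  define a b where "a = (l - 1) div q" and "b = (l - 1) mod q + 1"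
  have l: "l + q - 1 = (l - 1) + q" using assms by simp
  have "(l + q - 1) div q = Suc a" "(l + q - 1) mod q + 1 = b"
    unfolding l a_def b_def using q(1) by simp_all
  then have 1: "mspike p (l + q) = (b + 1) * p ^ Suc a - 1"
    using assms(2) unfolding mspike_def spike_entry_def Let_def q_def[symmetric] by simp
  have 2: "mspike p l = (b + 1) * p ^ a - 1"
    using assms(2) unfolding mspike_def spike_entry_def Let_def a_def b_def q_def[symmetric] by simp
  have "(b + 1) * p ^ a \<noteq> 0" using assms(1) by simp
  then obtain x where x: "(b + 1) * p ^ a = Suc x" by (rule not0_implies_Suc[THEN exE])
  have "(b + 1) * p ^ Suc a = p * ((b + 1) * p ^ a)" by (simp only: power_Suc mult_ac)
  then have "(b + 1) * p ^ Suc a = p * Suc x" unfolding x .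
  then show ?thesis using 1 2 x q by (simp add: q_def[symmetric])
qed

lemma mspike_strict_mono:
  assumes "2 \<le> p"
  shows "strict_mono (mspike p)"
  unfolding strict_mono_Suc_iff
proof
  fix l show "mspike p l < mspike p (Suc l)"
  proof (induction l rule: less_induct)
    case (less l)
    consider "l < p - 1" | "l = p - 1" | "l > p - 1" by linarith
    then show ?case
    proof cases
      case 1 then show ?thesis by (simp add: mspike_small)
    next
      case 2
      then show ?thesis using mspike_shift[OF assms, of 1] mspike_small[of 1 p] mspike_small[of l p] assms by simp
    next
      case 3
      define l' where "l' = l - (p - 1)"
      have "l = l' + (p - 1)" "l' > 0" "l' < l" using 3 assms by (auto simp: l'_def)
      then have "p * mspike p l' < p * mspike p (Suc l')"
        using less[of l'] assms by simp
      moreover have "mspike p l = p * mspike p l' + (p - 1)"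
        using mspike_shift[OF assms \<open>l' > 0\<close>] \<open>l = _\<close> by simp
      moreover have "mspike p (Suc l) = p * mspike p (Suc l') + (p - 1)"
        using mspike_shift[OF assms, of "Suc l'"] \<open>l = _\<close> by simp
      ultimately show ?thesis by linarith
    qed
  qed
qed

lemma mspike_eq_sum_digits:
  assumes "2 \<le> p" "l \<le> M * (p - 1)"
  shows "mspike p l = (\<Sum>c<M. min (p - 1) (l - c * (p - 1)) * p ^ c)"
  using assms(2)
proof (induction M arbitrary: l)
  case (Suc M)
  have "(\<Sum>c<M. min (p - 1) (l - Suc c * (p - 1)) * p ^ Suc c)
      = p * (\<Sum>c<M. min (p - 1) (l - (p - 1) - c * (p - 1)) * p ^ c)"
    by (simp add: sum_distrib_left mult_ac)
  also have "\<dots> = p * mspike p (l - (p - 1))"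
    using Suc.prems by (subst Suc.IH) auto
  finally have "(\<Sum>c<Suc M. min (p - 1) (l - c * (p - 1)) * p ^ c) = min (p - 1) l + p * mspike p (l - (p - 1))"
    by (subst sum.lessThan_Suc_shift) simp
  also have "\<dots> = mspike p l"
  proof (cases "l \<le> p - 1")
    case False
    then show ?thesis using mspike_shift[OF assms(1), of "l - (p - 1)"] by simp
  qed (simp add: mspike_small)
  finally show ?case by simp
qed simp

text \<open>
  The digit sum in base \<open>p\<close>, equivalently the least number of powers of \<open>p\<close> with a given sum.
\<close>

fun dsum :: "nat \<Rightarrow> nat \<Rightarrow> nat" where
  "dsum p n = (if n = 0 \<or> p \<le> 1 then 0 else n mod p + dsum p (n div p))"

declare dsum.simps [simp del]

lemma dsum_0 [simp]: "dsum p 0 = 0"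
  by (simp add: dsum.simps)

lemma dsum_rec: "2 \<le> p \<Longrightarrow> dsum p n = n mod p + dsum p (n div p)"
  by (cases "n = 0") (simp_all add: dsum.simps[of p n])

lemma dsum_digit: "2 \<le> p \<Longrightarrow> r < p \<Longrightarrow> dsum p (p * n + r) = r + dsum p n"
  by (subst dsum_rec) auto

lemma dsum_power [simp]: "2 \<le> p \<Longrightarrow> dsum p (p ^ c) = 1"
proof (induction c)
  case 0 then show ?case using dsum_digit[of p 1 0] by simp
next
  case (Suc c) then show ?case using dsum_digit[of p 0 "p ^ c"] by simp
qed

text \<open>
  Each carry in an addition replaces \<open>p\<close> units by one unit of the next place.
\<close>

lemma dsum_add_le:
  assumes p: "2 \<le> p"
  shows "dsum p (a + b) \<le> dsum p a + dsum p b"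
proof (induction "a + b" arbitrary: a b rule: less_induct)
  case less
  show ?case
  proof (cases "a + b = 0")
    case False
    define A B where "A = a div p" and "B = b div p"
    have "A \<le> a" "B \<le> b" "a > 0 \<Longrightarrow> A < a" "b > 0 \<Longrightarrow> B < b"
      using p by (simp_all add: A_def B_def)
    then have small: "A + B < a + b" using False by (cases "a > 0"; cases "b > 0") auto
    have IH: "dsum p (A + B) \<le> dsum p A + dsum p B" by (rule less) (rule small)
    have rec: "dsum p a = a mod p + dsum p A" "dsum p b = b mod p + dsum p B"
      "dsum p (a + b) = (a + b) mod p + dsum p ((a + b) div p)"
      unfolding A_def B_def by (rule dsum_rec[OF p])+
    have carry: "(a + b) mod p = (a mod p + b mod p) mod p"
      "(a + b) div p = A + B + (a mod p + b mod p) div p"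
      unfolding A_def B_def by (simp add: mod_add_eq) (rule div_add1_eq)
    show ?thesis
    proof (cases "a mod p + b mod p < p")
      case True
      then have "(a + b) mod p = a mod p + b mod p" "(a + b) div p = A + B"
        unfolding carry by simp_all
      then show ?thesis using IH rec by simp
    next
      case False
      have lt: "a mod p < p" "b mod p < p" using p by simp_all
      then have "a mod p + b mod p - p < p" by linarith
      then have "(a mod p + b mod p) mod p = a mod p + b mod p - p" "(a mod p + b mod p) div p = 1"
        using False by (simp_all add: le_mod_geq le_div_geq)
      then have eq: "(a + b) mod p = a mod p + b mod p - p" "(a + b) div p = A + B + 1"
        unfolding carry by simp_all
      have "A + B + 1 < a + b"
      proof -
        have "(a + b) div p < a + b" using \<open>a + b \<noteq> 0\<close> p by simp
        then show ?thesis using eq by simp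
      qed
      then have "dsum p (A + B + 1) \<le> dsum p (A + B) + dsum p 1"
        by (intro less) auto
      then show ?thesis
        using IH rec eq False p dsum_power[OF p, of 0] by simp
    qed
  qed simp
qed

lemma dsum_mspike:
  assumes "2 \<le> p"
  shows "dsum p (mspike p l) = l"
proof (induction l rule: less_induct)
  case (less l)
  show ?case
  proof (cases "l \<le> p - 1")
    case True
    then show ?thesis using dsum_digit[OF assms, of l 0] assms by (simp add: mspike_small)
  next
    case False
    then show ?thesis
      using mspike_shift[OF assms, of "l - (p - 1)"] less[of "l - (p - 1)"]
        dsum_digit[OF assms, of "p - 1"] assms by simp
  qed
qed

text \<open>
  The entries of Milnor spikes are the least numbers with given digit sum: to keep a number small, fill the
  low places with \<open>p - 1\<close> first.
\<close>

lemma mspike_dsum_le: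
  assumes "2 \<le> p"
  shows "mspike p (dsum p n) \<le> n"
proof (induction n rule: less_induct)
  case (less n)
  show ?case
  proof (cases "n < p")
    case True
    then show ?thesis using dsum_digit[OF assms, of n 0] by (simp add: mspike_small)
  next
    case False
    define n' r l where "n' = n div p" and "r = n mod p" and "l = dsum p n'"
    have n: "n = p * n' + r" and r: "r \<le> p - 1" and n': "n' < n"
      using assms False by (auto simp: n'_def r_def less_Suc_eq_le[symmetric])
    have IH: "mspike p l \<le> n'" unfolding l_def using n' by (rule less)
    have dn: "dsum p n = r + l" using dsum_rec[OF assms, of n] by (simp add: n'_def r_def l_def)
    show ?thesis
    proof (cases "l = 0")
      case True
      then show ?thesis using dn r n by (simp add: mspike_small)
    next
      case l: False
      have gap: "mspike p x + k \<le> mspike p (x + k)" for x k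
      proof (induction k)
        case (Suc k)
        then show ?case
          using strict_monoD[OF mspike_strict_mono[OF assms], of "x + k" "x + Suc k"] by simp
      qed simp
      have "mspike p (l + r) + (p - 1 - r) \<le> p * mspike p l + (p - 1)"
      proof -
        have eq: "l + r + (p - 1 - r) = l + (p - 1)" using r by simp
        show ?thesis
          using gap[of "l + r" "p - 1 - r", unfolded eq] mspike_shift[OF assms, of l] l by simp
      qed
      then have "mspike p (l + r) \<le> p * n' + r" using r mult_le_mono2[OF IH, of p] by linarith
      then show ?thesis using n dn by (metis add.commute)
    qed
  qed
qed

lemma sum_digits_less:
  fixes d :: "nat \<Rightarrow> nat"
  assumes "2 \<le> p" "\<And>c. d c \<le> p - 1"
  shows "(\<Sum>c<k. d c * p ^ c) < p ^ k"
proof (induction k)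
  case (Suc k)
  have "d k * p ^ k \<le> (p - 1) * p ^ k" using assms(2) by simp
  moreover have "(\<Sum>c<Suc k. d c * p ^ c) = (\<Sum>c<k. d c * p ^ c) + d k * p ^ k" by simp
  ultimately have "(\<Sum>c<Suc k. d c * p ^ c) < p ^ k + (p - 1) * p ^ k" using Suc by linarith
  also have "\<dots> = p ^ Suc k" using assms(1) by (cases p) auto
  finally show ?case .
qed simp

section \<open>Digit sums bound the operations\<close>

definition weight :: "nat \<Rightarrow> (nat \<Rightarrow>\<^sub>0 nat) \<Rightarrow> nat" where
  "weight p e = (\<Sum>u\<in>keys e. dsum p (lookup e u))"

lemma weight_superset: "finite A \<Longrightarrow> keys e \<subseteq> A \<Longrightarrow> weight p e = (\<Sum>u\<in>A. dsum p (lookup e u))"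
  unfolding weight_def by (rule sum.mono_neutral_left) (auto simp: in_keys_iff)

lemma additive_family_weight:
  assumes "2 \<le> p"
  shows "additive_family (\<lambda>n e. weight p e \<le> n)"
  unfolding additive_family_def
proof (intro conjI allI impI)
  fix a b d e assume le: "weight p d \<le> a" "weight p e \<le> b"
  have K: "keys (d + e) \<subseteq> keys d \<union> keys e" by (rule keys_add)
  have "weight p (d + e) = (\<Sum>u\<in>keys d \<union> keys e. dsum p (lookup d u + lookup e u))"
    using weight_superset[OF _ K] by (simp add: lookup_add)
  also have "\<dots> \<le> (\<Sum>u\<in>keys d \<union> keys e. dsum p (lookup d u) + dsum p (lookup e u))"
    by (intro sum_mono dsum_add_le assms)
  also have "\<dots> = weight p d + weight p e"
    using weight_superset[of "keys d \<union> keys e" d p] weight_superset[of "keys d \<union> keys e" e p]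
    by (simp add: sum.distrib)
  finally show "weight p (d + e) \<le> a + b" using le by simp
qed (simp add: weight_def)

lemma linear_form_power_char:
  fixes m :: "nat \<Rightarrow> 'a::comm_ring_1 mpoly"
  assumes "prime p" "CHAR('a) = p"
  shows "(\<Sum>u\<in>A. var u * cst (m u)) ^ (p ^ c) = (\<Sum>u\<in>A. var u ^ (p ^ c) * cst (m u ^ (p ^ c)))"
  using assms by (subst freshmans_dream_sum') (simp_all add: CHAR_mpoly power_mult_distrib cst.hom_power)

text \<open>
  By the Frobenius endomorphism the \<open>p\<^sup>c\<close>th power of a linear form is a combination of the \<open>p\<^sup>c\<close>th powers of the
  variables, which have digit sum 1. A \<open>k\<close>th power is a product of \<open>dsum p k\<close> factors of this kind.
\<close>

lemma graded_linear_form_power: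
  fixes m :: "nat \<Rightarrow> 'a::comm_ring_1 mpoly"
  assumes "prime p" "CHAR('a) = p"
  shows "graded (\<lambda>n e. weight p e \<le> n) (dsum p k) ((\<Sum>u\<in>A. var u * cst (m u)) ^ k)"
proof -
  have p: "2 \<le> p" using assms(1) by (rule prime_ge_2_nat)
  note add = additive_family_weight[OF p]
  define L where "L c = (\<Sum>u\<in>A. var u * cst (m u)) ^ (p ^ c)" for c
  have "graded (\<lambda>n e. weight p e \<le> n) 1 (var u ^ (p ^ c) :: 'a mpoly mpoly)" for u c
    using p by (simp add: var_power graded_single weight_def)
  then have L: "graded (\<lambda>n e. weight p e \<le> n) 1 (L c)" for c
    unfolding L_def linear_form_power_char[OF assms]
    by (intro graded_sum, subst mult.commute, intro graded_cst_mult[OF add])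
  have "graded (\<lambda>n e. weight p e \<le> n) (dsum p k) (L c ^ k)" for c
  proof (induction k arbitrary: c rule: less_induct)
    case (less k)
    show ?case
    proof (cases "k = 0")
      case True
      then show ?thesis using graded_cst[OF add, of 1] by simp
    next
      case False
      have "L (Suc c) ^ (k div p) = L c ^ (p * (k div p))"
        by (simp add: L_def power_mult[symmetric] mult_ac)
      then have "L c ^ k = L c ^ (k mod p) * L (Suc c) ^ (k div p)"
        by (simp flip: power_add)
      moreover have "graded (\<lambda>n e. weight p e \<le> n) (k mod p * 1 + dsum p (k div p)) (L c ^ (k mod p) * L (Suc c) ^ (k div p))"
        using False p by (intro graded_mult[OF add] graded_power[OF add] L less) auto
      ultimately show ?thesis by (simp add: dsum_rec[OF p, of k])
    qed
  qed
  from this[of 0] show ?thesis by (simp add: L_def)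
qed

text \<open>
  The obstruction that makes \<open>P(R)\<close> vanish on all monomials of \<open>v(\<lambda>)\<close> but one.
\<close>

lemma weight_le_of_lookup_hop:
  assumes "prime p" "CHAR('k::comm_ring_1) = p"
    and "lookup (hop p t (single e 1 :: 'k mpoly)) R \<noteq> 0"
  shows "weight p R \<le> weight p e"
proof -
  have add: "additive_family (\<lambda>n e. weight p e \<le> n)"
    by (rule additive_family_weight) (rule prime_ge_2_nat[OF assms(1)])
  have "graded (\<lambda>n e. weight p e \<le> n) (weight p e) (hop p t (single e 1 :: 'k mpoly))"
    unfolding hop_single weight_def[of p e] monom_eval_def
    by (intro graded_cst_mult[OF add] graded_prod[OF add] graded_linear_form_power assms)
  then show ?thesis using assms(3) by (auto simp: graded_def in_keys_iff)
qed

section \<open>Products of linear forms with staircase exponents\<close>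

lemma minor_hom:
  assumes "comm_ring_hom \<phi>"
  shows "minor (\<lambda>i u. \<phi> (m i u)) k = \<phi> (minor m k)"
proof -
  have "mat k k (\<lambda>(i, u). \<phi> (m i u)) = map_mat \<phi> (mat k k (\<lambda>(i, u). m i u))"
    by (rule eq_matI) auto
  then show ?thesis unfolding minor_def by (simp add: comm_ring_hom.hom_det[OF assms])
qed

lemma comm_ring_hom_frobenius:
  assumes "prime p" "CHAR('a::comm_ring_1) = p"
  shows "comm_ring_hom (\<lambda>x :: 'a. x ^ (p ^ c))"
  using assms prime_gt_0_nat[of p]
  by unfold_locales (simp_all add: freshmans_dream' power_mult_distrib power_0_left)

lemma prod_staircase:
  fixes x :: "nat \<Rightarrow> 'a::comm_ring_1"
  assumes "f < n" "\<And>u. u < f \<Longrightarrow> d u = q" "\<And>u. f < u \<Longrightarrow> d u = 0"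
  shows "(\<Prod>u<n. x u ^ d u) = (\<Prod>u<f. x u ^ q) * x f ^ d f"
proof -
  have "(\<Prod>u<n. x u ^ d u) = (\<Prod>u\<in>insert f {..<f}. x u ^ d u)"
  proof (intro prod.mono_neutral_right ballI)
    fix u assume "u \<in> {..<n} - insert f {..<f}"
    then have "f < u" by auto
    then show "x u ^ d u = 1" by (simp add: assms(3))
  qed (use assms(1) in auto)
  also have "\<dots> = x f ^ d f * (\<Prod>u<f. x u ^ q)"
    using assms(2) by simp
  finally show ?thesis by (simp add: mult.commute)
qed

text \<open>
  \<open>d u c\<close> is the digit of the exponent at place \<open>p\<^sup>c\<close>, both for the power of the \<open>u\<close>th form and for the variable
  \<open>var (u + h)\<close>. The forms raised to the power \<open>p\<^sup>c\<close> are linear forms in \<open>var (u + h) ^ p ^ c\<close>. They are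
  evaluated from the highest level down: once the digits above \<open>c\<close> have been used, the variables can only be
  multiplied by as much as the digit at \<open>c\<close> allows without leaving the exponents of \<open>R\<close>, which is the
  hypothesis of the elimination lemma.
\<close>

lemma staircase_product_mod_null:
  fixes m :: "nat \<Rightarrow> nat \<Rightarrow> 'a::idom mpoly" and d :: "nat \<Rightarrow> nat \<Rightarrow> nat"
  assumes p: "prime p" "CHAR('a) = p"
    and f: "\<And>c. c < M \<Longrightarrow> f c < n"
    and full: "\<And>c u. c < M \<Longrightarrow> u < f c \<Longrightarrow> d u c = p - 1"
    and empty: "\<And>c u. c < M \<Longrightarrow> f c < u \<Longrightarrow> d u c = 0"
    and digit: "\<And>u c. d u c \<le> p - 1"
    and nonzero: "\<And>j. j < n \<Longrightarrow> minor m j \<noteq> 0"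
    and R: "\<And>u. u < n \<Longrightarrow> lookup R (u + h) = (\<Sum>c<M. d u c * p ^ c)"
  shows "(\<Prod>i<n. (\<Sum>u<n. var (u + h) * cst (m i u)) ^ (\<Sum>c<M. d i c * p ^ c))
    - cst (\<Prod>c<M. (minor m (Suc (f c)) ^ d (f c) c * minor m (f c) ^ (p - 1 - d (f c) c)) ^ p ^ c)
      * (\<Prod>u<n. var (u + h) ^ (\<Sum>c<M. d u c * p ^ c)) \<in> null R"
proof -
  have p2: "2 \<le> p" using p(1) by (rule prime_ge_2_nat)
  have char: "CHAR('a mpoly) = p" "CHAR('a mpoly mpoly) = p"
    using p(2) by (simp_all add: CHAR_mpoly)
  note I = ring_ideal_null[of R]
  define y :: "nat \<Rightarrow> nat \<Rightarrow> 'a mpoly mpoly" where "y c u = var (u + h) ^ p ^ c" for c u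
  define m' where "m' c i u = cst (m i u ^ p ^ c)" for c i u
  define l where "l c i = (\<Sum>u<n. y c u * m' c i u)" for c i
  define E where "E c = (\<Prod>i<n. l c i ^ d i c)" for c
  define coef where "coef c = (minor m (Suc (f c)) ^ d (f c) c * minor m (f c) ^ (p - 1 - d (f c) c)) ^ p ^ c" for c
  \<comment> \<open>The part of the target monomial that the levels from \<open>j\<close> on contribute.\<close>
  define Y :: "nat \<Rightarrow> 'a mpoly mpoly" where "Y j = (\<Prod>u<n. var (u + h) ^ (\<Sum>c\<in>{j..<M}. d u c * p ^ c))" for j
  have minor': "minor (m' c) k = cst (minor m k ^ p ^ c)" for c k
  proof -
    have "comm_ring_hom (\<lambda>x :: 'a mpoly. cst (x ^ p ^ c))"
    proof -
      interpret comm_ring_hom "\<lambda>x :: 'a mpoly. x ^ p ^ c"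
        by (rule comm_ring_hom_frobenius[OF p(1) char(1)])
      show ?thesis by unfold_locales (simp_all add: hom_add hom_mult cst_add cst_mult)
    qed
    from minor_hom[OF this] show ?thesis unfolding m'_def .
  qed
  have level: "E j * Y (Suc j) - cst (coef j) * Y j \<in> null R" if j: "j < M" for j
  proof -
    have split: "(\<Prod>u<n. x u ^ d u j) = (\<Prod>u<f j. x u ^ (p - 1)) * x (f j) ^ d (f j) j"
      for x :: "nat \<Rightarrow> 'a mpoly mpoly"
      using f[OF j] full[OF j] empty[OF j] by (rule prod_staircase)
    \<comment> \<open>One more factor than the digit at level \<open>j\<close> overshoots the exponent, since the lower digits
      together are less than \<open>p ^ j\<close>.\<close>
    have kill: "y j u ^ Suc (d u j) * Y (Suc j) \<in> null R" if u: "u < n" for u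
    proof -
      have "(\<Sum>c<M. d u c * p ^ c) = (\<Sum>c<Suc j. d u c * p ^ c) + (\<Sum>c\<in>{Suc j..<M}. d u c * p ^ c)"
        using j by (subst sum.union_disjoint[symmetric]) (auto intro: sum.cong)
      also have "(\<Sum>c<Suc j. d u c * p ^ c) = (\<Sum>c<j. d u c * p ^ c) + d u j * p ^ j" by simp
      also have "(\<Sum>c<j. d u c * p ^ c) < p ^ j"
        using p2 digit by (rule sum_digits_less)
      finally have "lookup R (u + h) < p ^ j * Suc (d u j) + (\<Sum>c\<in>{Suc j..<M}. d u c * p ^ c)"
        using R[OF u] by (simp add: mult.commute)
      then have "var (u + h) ^ (p ^ j * Suc (d u j) + (\<Sum>c\<in>{Suc j..<M}. d u c * p ^ c)) \<in> (null R :: 'a mpoly mpoly set)"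
        by (rule var_power_in_null)
      from ring_idealD(4)[OF I this, of "\<Prod>v\<in>{..<n} - {u}. var (v + h) ^ (\<Sum>c\<in>{Suc j..<M}. d v c * p ^ c)"]
      show ?thesis
        unfolding Y_def using u
        by (subst prod.remove[of _ u]) (simp_all only: y_def power_mult[symmetric] power_add mult_ac finite_lessThan lessThan_iff)
    qed
    have local: "((\<Prod>i<f j. l j i ^ (p - 1)) * l j (f j) ^ d (f j) j
      - minor (m' j) (Suc (f j)) ^ d (f j) j * minor (m' j) (f j) ^ (p - 1 - d (f j) j)
        * ((\<Prod>u<f j. y j u ^ (p - 1)) * y j (f j) ^ d (f j) j)) * Y (Suc j) \<in> null R"
      unfolding l_def
    proof (rule prod_linear_forms_mod_ideal[OF p(1) char(2) I])
      show "x \<in> null R" if "k < n" "minor (m' j) k * x \<in> null R" for k x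
        using null_cancel_cst[of "minor m k ^ p ^ j" x R] that nonzero[OF that(1)] minor' by simp
      show "y j u ^ p * Y (Suc j) \<in> null R" if "u < f j" for u
        using kill[of u] full[OF j that] f[OF j] that p2 by simp
      show "y j (f j) ^ Suc (d (f j) j) * Y (Suc j) \<in> null R"
        by (rule kill[OF f[OF j]])
      show "y j u * Y (Suc j) \<in> null R" if "f j < u" "u < n" for u
        using kill[of u] empty[OF j that(1)] that by simp
    qed (use f[OF j] digit in auto)
    have coef: "minor (m' j) (Suc (f j)) ^ d (f j) j * minor (m' j) (f j) ^ (p - 1 - d (f j) j) = cst (coef j)"
      by (simp add: minor' coef_def cst_mult cst.hom_power power_mult_distrib power_mult[symmetric] mult.commute)
    have Y: "(\<Prod>u<f j. y j u ^ (p - 1)) * y j (f j) ^ d (f j) j * Y (Suc j) = Y j"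
    proof -
      have "(\<Prod>u<n. y j u ^ d u j) * Y (Suc j) = Y j"
        unfolding Y_def y_def prod.distrib[symmetric] using j
        by (intro prod.cong refl)
          (simp add: sum.atLeast_Suc_lessThan power_add power_mult[symmetric] mult.commute)
      then show ?thesis unfolding split[of "y j"] .
    qed
    show ?thesis
      using local unfolding E_def split coef[symmetric] Y[symmetric]
      by (simp only: left_diff_distrib mult.assoc)
  qed
  have claim: "(\<Prod>c\<in>{j..<M}. E c) - cst (\<Prod>c\<in>{j..<M}. coef c) * Y j \<in> null R" if "j \<le> M" for j
    using that
  proof (induction j rule: inc_induct)
    case base
    then show ?case using ring_idealD(1)[OF I] by (simp add: Y_def)
  next
    case (step j)
    have 1: "E j * (\<Prod>c\<in>{Suc j..<M}. E c) - E j * (cst (\<Prod>c\<in>{Suc j..<M}. coef c) * Y (Suc j)) \<in> null R"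
      using ring_idealD(3)[OF I step.IH, of "E j"] by (simp add: right_diff_distrib)
    have 2: "E j * (cst (\<Prod>c\<in>{Suc j..<M}. coef c) * Y (Suc j))
        - cst (\<Prod>c\<in>{Suc j..<M}. coef c) * (cst (coef j) * Y j) \<in> null R"
      using ring_idealD(3)[OF I level[OF step.hyps(2)], of "cst (\<Prod>c\<in>{Suc j..<M}. coef c)"]
      by (simp add: right_diff_distrib mult_ac)
    from ring_ideal_diff_trans[OF I 1 2] show ?case
      using step.hyps by (simp add: prod.atLeast_Suc_lessThan cst_mult mult_ac)
  qed
  have "(\<Sum>u<n. var (u + h) * cst (m i u)) ^ p ^ c = l c i" for i c
    using p(1) char(2)
    by (simp add: l_def y_def m'_def freshmans_dream_sum' power_mult_distrib cst.hom_power)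
  then have "(\<Prod>i<n. (\<Sum>u<n. var (u + h) * cst (m i u)) ^ (\<Sum>c<M. d i c * p ^ c)) = (\<Prod>i<n. \<Prod>c<M. l c i ^ d i c)"
    by (simp add: power_sum power_mult[symmetric] mult.commute[of _ "_ ^ _"])
      (simp add: power_mult)
  also have "\<dots> = (\<Prod>c<M. E c)" unfolding E_def by (rule prod.swap)
  finally show ?thesis
    using claim[of 0] by (simp add: coef_def Y_def atLeast0LessThan)
qed

section \<open>Only the spike monomial survives\<close>

text \<open>
  Exponent vectors with spike entries, shifted by \<open>h\<close>: with \<open>h = 1\<close> the monomial \<open>s(\<lambda>)\<close> in \<open>x\<^sub>1, x\<^sub>2, \<dots>\<close>, and
  with \<open>h \<in> {0, 1}\<close> the two monomials in the outer variables at which coefficients are taken.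
\<close>

definition spike_key :: "nat \<Rightarrow> nat \<Rightarrow> (nat \<Rightarrow> nat) \<Rightarrow> nat \<Rightarrow> nat \<Rightarrow>\<^sub>0 nat" where
  "spike_key p n l h = (\<Sum>i<n. single (i + h) (mspike p (l i)))"

lemma lookup_spike_key:
  "lookup (spike_key p n l h) u = (if h \<le> u \<and> u < n + h then mspike p (l (u - h)) else 0)"
proof -
  have "lookup (spike_key p n l h) u = (\<Sum>i<n. if i = u - h \<and> h \<le> u then mspike p (l i) else 0)"
    unfolding spike_key_def lookup_sum by (intro sum.cong) (auto simp: lookup_single when_def)
  also have "\<dots> = (if h \<le> u \<and> u < n + h then mspike p (l (u - h)) else 0)"
    by (cases "h \<le> u") (auto simp: sum.delta)
  finally show ?thesis .
qed

lemma keys_spike_key: "keys (spike_key p n l h) \<subseteq> (\<lambda>i. i + h) ` {..<n}"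
proof
  fix u assume "u \<in> keys (spike_key p n l h)"
  then have "h \<le> u" "u < n + h" by (auto simp: in_keys_iff lookup_spike_key split: if_splits)
  then show "u \<in> (\<lambda>i. i + h) ` {..<n}" by (intro image_eqI[of _ _ "u - h"]) auto
qed

lemma tdeg_spike_key: "tdeg (spike_key p n l h) = (\<Sum>i<n. mspike p (l i))"
  by (simp add: spike_key_def tdeg_sum)

lemma weight_spike_key: "2 \<le> p \<Longrightarrow> weight p (spike_key p n l h) = (\<Sum>i<n. l i)"
  by (subst weight_superset[OF _ keys_spike_key])
    (simp_all add: sum.reindex inj_on_def lookup_spike_key dsum_mspike)

text \<open>
  The bounds on the digit sums must all be equalities. Then every exponent is at least the spike entry, by
  minimality, and equality of the degrees leaves no room.
\<close>

lemma eq_spike_key_of_weight_ge: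
  assumes p: "2 \<le> p" and e: "keys e \<subseteq> Suc ` {..<n}" "\<And>i. i < n \<Longrightarrow> dsum p (lookup e (Suc i)) \<le> l i"
    and deg: "tdeg e = (\<Sum>i<n. mspike p (l i))" and weight: "(\<Sum>i<n. l i) \<le> weight p e"
  shows "e = spike_key p n l 1"
proof -
  have "weight p e = (\<Sum>i<n. dsum p (lookup e (Suc i)))"
    using weight_superset[OF _ e(1)] by (simp add: sum.reindex)
  then have "dsum p (lookup e (Suc i)) = l i" if "i < n" for i
    using weight sum_mono_inv[of "\<lambda>i. dsum p (lookup e (Suc i))" "{..<n}" l i] e(2) that
      sum_mono[of "{..<n}" "\<lambda>i. dsum p (lookup e (Suc i))" l] by auto
  then have ge: "mspike p (l i) \<le> lookup e (Suc i)" if "i < n" for i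
    using mspike_dsum_le[OF p, of "lookup e (Suc i)"] that by simp
  have "tdeg e = (\<Sum>i<n. lookup e (Suc i))"
    using tdeg_superset[OF _ e(1)] by (simp add: sum.reindex)
  then have "mspike p (l i) = lookup e (Suc i)" if "i < n" for i
    using sum_mono_inv[of "\<lambda>i. mspike p (l i)" "{..<n}" "\<lambda>i. lookup e (Suc i)" i] ge deg that by simp
  moreover have "lookup e u = 0" if "u \<notin> Suc ` {..<n}" for u
    using e(1) that by (auto simp flip: in_keys_iff simp: in_keys_iff)
  ultimately show ?thesis
    by (intro poly_mapping_eqI) (auto simp: lookup_spike_key image_iff Suc_le_eq dest: gr0_implies_Suc)
qed

lemma lookup_hop_eq_spike_coefficient:
  fixes f :: "'k::comm_ring_1 mpoly"
  assumes p: "prime p" "CHAR('k) = p"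
    and f: "homog (\<Sum>i<n. mspike p (l i)) f"
      "\<And>e. e \<in> keys f \<Longrightarrow> keys e \<subseteq> Suc ` {..<n}"
      "\<And>e i. e \<in> keys f \<Longrightarrow> i < n \<Longrightarrow> dsum p (lookup e (Suc i)) \<le> l i"
    and R: "weight p R = (\<Sum>i<n. l i)"
  shows "lookup (hop p t f) R
    = cst (lookup f (spike_key p n l 1)) * lookup (hop p t (single (spike_key p n l 1) 1)) R"
proof -
  interpret hop: comm_ring_hom "hop p t :: 'k mpoly \<Rightarrow> _" by (rule comm_ring_hom_hop)
  have p2: "2 \<le> p" using p(1) by (rule prime_ge_2_nat)
  let ?s = "spike_key p n l 1"
  have hop_monom: "lookup (hop p t (single e c)) R = cst c * lookup (hop p t (single e 1)) R"
    for e and c :: 'k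
    by (simp add: hop_single lookup_cst_mult)
  have "lookup (hop p t f) R = (\<Sum>e\<in>keys f. cst (lookup f e) * lookup (hop p t (single e 1)) R)"
    by (subst mpoly_sum_monomials) (simp add: hop.hom_sum lookup_sum hop_monom[of _ "lookup f _"])
  also have "\<dots> = (\<Sum>e\<in>keys f. if e = ?s then cst (lookup f ?s) * lookup (hop p t (single ?s 1)) R else 0)"
  proof (rule sum.cong[OF refl])
    fix e assume e: "e \<in> keys f"
    have "e = ?s" if "lookup (hop p t (single e 1 :: 'k mpoly)) R \<noteq> 0"
      by (rule eq_spike_key_of_weight_ge)
        (use e f R p2 weight_le_of_lookup_hop[OF p that] in \<open>auto simp: homog_def graded_def\<close>)
    then show "cst (lookup f e) * lookup (hop p t (single e 1)) R
        = (if e = ?s then cst (lookup f ?s) * lookup (hop p t (single ?s 1)) R else 0)"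
      by (cases "lookup (hop p t (single e 1 :: 'k mpoly)) R = 0") auto
  qed
  also have "\<dots> = cst (lookup f ?s) * lookup (hop p t (single ?s 1)) R"
    by (auto simp: in_keys_iff)
  finally show ?thesis .
qed

section \<open>Leading terms\<close>

definition lead :: "'a::comm_ring_1 mpoly \<Rightarrow> (nat \<Rightarrow>\<^sub>0 nat) \<Rightarrow> 'a \<Rightarrow> bool" where
  "lead f e c \<longleftrightarrow> lookup f e = c \<and> (\<forall>d\<in>keys f. d \<le> e)"

lemma lead_single: "lead (single e c) e c"
  by (simp add: lead_def)

lemma lead_add_lower:
  assumes "lead f e c" "\<And>d. d \<in> keys g \<Longrightarrow> d < e"
  shows "lead (f + g) e c"
proof -
  have "lookup g e = 0" using assms(2)[of e] by (auto simp: in_keys_iff)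
  then show ?thesis
    using assms keys_add[of f g] by (fastforce simp: lead_def lookup_add intro: less_imp_le)
qed

lemma lead_mult:
  assumes "lead f d a" "lead g e b"
  shows "lead (f * g) (d + e) (a * b)"
proof -
  define f' where "f' = f - single d a"
  define g' where "g' = g - single e b"
  have f': "x < d" if "x \<in> keys f'" for x
    using assms(1) that by (auto simp: f'_def lead_def in_keys_iff lookup_minus lookup_single when_def le_less split: if_splits)
  have g': "x < e" if "x \<in> keys g'" for x
    using assms(2) that by (auto simp: g'_def lead_def in_keys_iff lookup_minus lookup_single when_def le_less split: if_splits)
  have "f * g = single (d + e) (a * b) + (f' * g + single d a * g')"
    by (simp add: f'_def g'_def mult_single algebra_simps flip: mult_single)
  moreover have "x < d + e" if x: "x \<in> keys (f' * g + single d a * g')" for x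
  proof -
    consider "x \<in> keys (f' * g)" | "x \<in> keys (single d a * g')"
      using x keys_add[of "f' * g" "single d a * g'"] by auto
    then show ?thesis
    proof cases
      case 1
      then obtain y z where "x = y + z" "y \<in> keys f'" "z \<in> keys g" using keys_mult[of f' g] by auto
      then show ?thesis using f' assms(2) by (auto simp: lead_def intro: add_less_le_mono)
    next
      case 2
      then obtain y z where "x = y + z" "y \<in> keys (single d a)" "z \<in> keys g'"
        using keys_mult[of "single d a" g'] by auto
      then show ?thesis using g' by (auto split: if_splits)
    qed
  qed
  ultimately show ?thesis by (metis lead_add_lower lead_single)
qed

lemma lead_prod:
  assumes "\<And>k. k \<in> A \<Longrightarrow> lead (f k) (e k) (c k)"
  shows "lead (\<Prod>k\<in>A. f k) (\<Sum>k\<in>A. e k) (\<Prod>k\<in>A. c k)"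
  using assms
proof (induction A rule: infinite_finite_induct)
  case (insert x A)
  then show ?case by (simp add: lead_mult)
qed (use lead_single[of 0 1] in simp_all)

lemma leading_monomial_lead:
  assumes "lead f e c" "c \<noteq> 0"
  shows "leading_monomial f = single e 1"
proof -
  have "Max (keys f) = e"
    using assms by (intro Max_eqI) (auto simp: lead_def in_keys_iff)
  then show ?thesis by (simp add: leading_monomial_def)
qed

lemma less_poly_mapping_at:
  fixes d e :: "nat \<Rightarrow>\<^sub>0 nat"
  assumes "lookup d k < lookup e k" "\<And>j. j < k \<Longrightarrow> lookup d j = lookup e j"
  shows "d < e"
  using assms by (auto simp: less_poly_mapping.rep_eq less_fun_def)

section \<open>Moore determinants\<close>

lemma graded_uminus: "graded P n f \<Longrightarrow> graded P n (- f)"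
  by (simp add: graded_def in_keys_iff)

lemma graded_det:
  assumes P: "additive_family P" and A: "A \<in> carrier_mat n n"
    and "\<And>i j. i < n \<Longrightarrow> j < n \<Longrightarrow> graded P (a i) (A $$ (i, j))"
  shows "graded P (\<Sum>i<n. a i) (det A)"
  unfolding det_def'[OF A]
proof (rule graded_sum)
  fix \<pi> assume "\<pi> \<in> {\<pi>. \<pi> permutes {0..<n}}"
  then have "graded P (\<Sum>i\<in>{0..<n}. a i) (\<Prod>i=0..<n. A $$ (i, \<pi> i))"
    using assms(3) by (intro graded_prod[OF P]) (auto dest: permutes_in_image)
  then show "graded P (\<Sum>i<n. a i) (signof \<pi> * (\<Prod>i=0..<n. A $$ (i, \<pi> i)))"
    by (simp add: sign_def atLeast0LessThan graded_uminus)
qed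

definition moore :: "nat \<Rightarrow> nat \<Rightarrow> nat \<Rightarrow> 'k::comm_ring_1 mpoly" where
  "moore p r k = det (mat k k (\<lambda>(a, b). var (r + b) ^ (p ^ a)))"

lemma bracket_eq_moore: "bracket (map (\<lambda>a. (r + a, p ^ a)) [0..<k]) = (moore p r k :: 'k::comm_ring_1 mpoly)"
proof -
  have "(mat k k (\<lambda>(a, b). var (fst (map (\<lambda>a. (r + a, p ^ a)) [0..<k] ! b)) ^ snd (map (\<lambda>a. (r + a, p ^ a)) [0..<k] ! a)) :: 'k mpoly mat)
      = mat k k (\<lambda>(a, b). var (r + b) ^ (p ^ a))"
    by (rule eq_matI) auto
  then show ?thesis by (simp add: bracket_def moore_def)
qed

lemma w_poly_eq_moore: "w_poly p k = moore p 1 k"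
  unfolding w_poly_def bracket_eq_moore[symmetric] by (simp add: add.commute)

lemma minor_eq_w_poly: "minor (\<lambda>i u. var (Suc i) ^ (p ^ u)) k = (w_poly p k :: 'k::comm_ring_1 mpoly)"
proof -
  have eq: "(mat k k (\<lambda>(i, u). var (Suc i) ^ (p ^ u)) :: 'k mpoly mat) = transpose_mat (mat k k (\<lambda>(a, b). var (1 + b) ^ (p ^ a)))"
    by (rule eq_matI) auto
  show ?thesis
    unfolding w_poly_eq_moore minor_def moore_def eq by (rule det_transpose[of _ k]) simp
qed

lemma homog_moore: "homog (\<Sum>a<k. p ^ a) (moore p r k)"
  unfolding homog_def moore_def
  by (rule graded_det[OF additive_family_tdeg]) (auto simp: homog_var_power[unfolded homog_def])

lemma additive_family_support: "additive_family (\<lambda>_ e. keys e \<subseteq> B)"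
  using keys_add by (fastforce simp: additive_family_def)

lemma graded_support_moore: "graded (\<lambda>_ e. keys e \<subseteq> {r..<r + k}) 0 (moore p r k)"
proof -
  have "graded (\<lambda>_ e. keys e \<subseteq> {r..<r + k}) (\<Sum>a<k. 0) (moore p r k)"
    unfolding moore_def
    by (rule graded_det[OF additive_family_support]) (auto simp: var_power graded_single)
  then show ?thesis by simp
qed

lemma additive_family_dsum_at:
  assumes "2 \<le> p"
  shows "additive_family (\<lambda>n e. dsum p (lookup e i) \<le> n)"
  unfolding additive_family_def lookup_add
  by (auto intro!: order.trans[OF dsum_add_le[OF assms]] add_mono)

text \<open>
  Each variable occurs in one column only, and its exponents there are powers of \<open>p\<close>. So the determinant is
  graded by columns, which is a grading by rows of the transpose.
\<close>

lemma graded_dsum_moore: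
  assumes p: "2 \<le> p"
  shows "graded (\<lambda>n e. dsum p (lookup e i) \<le> n) (if r \<le> i \<and> i < r + k then 1 else 0)
    (moore p r k :: 'k::comm_ring_1 mpoly)"
proof -
  have "graded (\<lambda>n e. dsum p (lookup e i) \<le> n) (\<Sum>b<k. if b + r = i then 1 else 0)
      (det (transpose_mat (mat k k (\<lambda>(a, b). var (r + b) ^ (p ^ a))) :: 'k mpoly mat))"
    using p by (intro graded_det[OF additive_family_dsum_at])
      (auto simp: var_power intro!: graded_single simp: lookup_single when_def add.commute)
  moreover have "(\<Sum>b<k. if b + r = i then 1 else 0) = (if r \<le> i \<and> i < r + k then 1 else 0 :: nat)"
  proof -
    have "(\<Sum>b<k. if b + r = i then 1 else 0) = (\<Sum>b<k. if b = i - r then (if r \<le> i then 1 else 0) else 0 :: nat)"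
      by (intro sum.cong) auto
    then show ?thesis by auto
  qed
  ultimately show ?thesis
    using det_transpose[of "mat k k (\<lambda>(a, b). var (r + b) ^ (p ^ a)) :: 'k mpoly mat" k]
    by (simp add: moore_def)
qed

text \<open>
  Among the entries of the first column the one in the last row has the highest power of the first
  variable. The expansion along that column thus gives the reversed diagonal by induction, with the sign of
  the reversal: moving the last row to the top contributes \<open>(-1)\<^sup>k\<close>.
\<close>

lemma lead_moore:
  assumes p: "2 \<le> p"
  shows "lead (moore p r k :: 'k::comm_ring_1 mpoly) (\<Sum>a<k. single (r + a) (p ^ (k - 1 - a))) ((-1) ^ (k div 2))"
proof (induction k arbitrary: r)
  case 0
  have "moore p r 0 = (single 0 1 :: 'k mpoly)" by (simp add: moore_def)
  then show ?case using lead_single[of 0 1] by simp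
next
  case (Suc k)
  define A where "A = mat (Suc k) (Suc k) (\<lambda>(a, b). var (r + b) ^ (p ^ a) :: 'k mpoly)"
  have A: "A \<in> carrier_mat (Suc k) (Suc k)" by (simp add: A_def)
  define rest where "rest = (\<Sum>i<k. A $$ (i, 0) * cofactor A i 0)"
  define e where "e = (\<Sum>a<Suc k. single (r + a) (p ^ (Suc k - 1 - a)))"
  have e: "e = single r (p ^ k) + (\<Sum>a<k. single (Suc r + a) (p ^ (k - 1 - a)))"
    unfolding e_def by (subst sum.lessThan_Suc_shift) simp
  have "mat_delete A k 0 = mat k k (\<lambda>(a, b). var (Suc r + b) ^ (p ^ a))"
    by (rule eq_matI) (auto simp: mat_delete_def A_def)
  then have cof: "cofactor A k 0 = (-1) ^ k * moore p (Suc r) k"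
    by (simp add: cofactor_def moore_def)
  have "moore p r (Suc k) = (\<Sum>i<Suc k. A $$ (i, 0) * cofactor A i 0)"
    unfolding moore_def A_def[symmetric] by (rule laplace_expansion_column[OF A]) simp
  also have "\<dots> = var r ^ (p ^ k) * ((-1) ^ k * moore p (Suc r) k) + rest"
    by (simp add: rest_def cof) (simp add: A_def)
  finally have eq: "moore p r (Suc k) = var r ^ (p ^ k) * ((-1) ^ k * moore p (Suc r) k) + rest" .
  have sgn: "(-1) ^ k = (single 0 ((-1) ^ k) :: 'k mpoly)"
    using cst.hom_power[of "-1 :: 'k" k] by (simp add: cst_def[symmetric] cst.hom_uminus)
  have "(-1 :: 'k) ^ k * (-1) ^ (k div 2) = (-1) ^ (Suc k div 2)"
    by (cases "even k") (auto elim!: evenE oddE simp: power_add power_mult)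
  then have top: "lead (var r ^ (p ^ k) * ((-1) ^ k * moore p (Suc r) k) :: 'k mpoly) e ((-1) ^ (Suc k div 2))"
    unfolding e var_power sgn
    using lead_mult[OF lead_single lead_mult[OF lead_single Suc], of "single r (p ^ k)" 1 0 "(-1) ^ k" "Suc r"]
    by simp
  have low: "d < e" if d: "d \<in> keys rest" for d
  proof -
    obtain i where i: "i < k" "d \<in> keys (A $$ (i, 0) * cofactor A i 0)"
      using d keys_sum[of "\<lambda>i. A $$ (i, 0) * cofactor A i 0" "{..<k}"] by (auto simp: rest_def)
    have A0: "A $$ (i, 0) = single (single r (p ^ i)) 1" using i by (simp add: A_def var_power)
    have del: "mat_delete A i 0 \<in> carrier_mat k k" by (simp add: mat_delete_def A_def)
    have "graded (\<lambda>_ e. keys e \<subseteq> {Suc r..}) (\<Sum>a<k. 0) (det (mat_delete A i 0))"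
      by (rule graded_det[OF additive_family_support del])
        (auto simp: mat_delete_def A_def var_power graded_single)
    then have "graded (\<lambda>_ e. keys e \<subseteq> {Suc r..}) 0 (cofactor A i 0)"
      by (cases "even i") (simp_all add: cofactor_def graded_uminus)
    moreover obtain d' where "d = single r (p ^ i) + d'" "d' \<in> keys (cofactor A i 0)"
      using i keys_mult[of "A $$ (i, 0)" "cofactor A i 0"] by (auto simp: A0 split: if_splits)
    ultimately have d': "keys d' \<subseteq> {Suc r..}" "d = single r (p ^ i) + d'"
      by (auto simp: graded_def)
    have zero: "lookup d' u = 0" if "u \<le> r" for u
      using d'(1) that by (force simp flip: in_keys_iff simp: in_keys_iff)
    show ?thesis
    proof (rule less_poly_mapping_at[of _ r])
      have "p ^ i < p ^ k" using i(1) p by (intro power_strict_increasing) auto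
      then show "lookup d r < lookup e r"
        using zero by (simp add: d' e lookup_add lookup_sum lookup_single when_def)
      show "lookup d j = lookup e j" if "j < r" for j
        using zero that by (simp add: d' e lookup_add lookup_sum lookup_single when_def)
    qed
  qed
  show ?case unfolding eq e_def[symmetric] by (rule lead_add_lower[OF top low])
qed

lemma w_poly_nonzero:
  assumes "2 \<le> p"
  shows "w_poly p k \<noteq> (0 :: 'k::idom mpoly)"
  using lead_moore[OF assms, of 1 k, where 'k = 'k]
  by (auto simp: w_poly_eq_moore lead_def)

section \<open>Powers of Moore determinants of decreasing sizes\<close>

lemma det_upper_triangular_prod:
  assumes "\<And>a i. i < a \<Longrightarrow> T a i = 0"
  shows "det (mat k k (\<lambda>(a, i). T a i)) = (\<Prod>a<k. T a a)"
proof -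
  have "det (mat k k (\<lambda>(a, i). T a i)) = prod_list (diag_mat (mat k k (\<lambda>(a, i). T a i)))"
    by (rule det_upper_triangular[of _ k]) (auto simp: upper_triangular_def assms)
  also have "\<dots> = prod_list (map (\<lambda>a. T a a) [0..<k])"
    unfolding diag_mat_def by (intro arg_cong[of _ _ prod_list] map_cong) auto
  also have "\<dots> = (\<Prod>a<k. T a a)"
    by (simp add: prod.distinct_set_conv_list[symmetric] atLeast0LessThan)
  finally show ?thesis .
qed

lemma repunit_eq: "0 < p \<Longrightarrow> (\<Sum>a<k. p ^ a) * (p - 1) = p ^ k - (1::nat)"
proof (induction k)
  case (Suc k)
  then obtain q where q: "p = Suc q" by (cases p) auto
  have "p ^ k \<ge> 1" using Suc.prems by simp
  have "(\<Sum>a<Suc k. p ^ a) * (p - 1) = p ^ k - 1 + p ^ k * (p - 1)"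
    using Suc by (simp add: distrib_right)
  also have "\<dots> = p ^ Suc k - 1" using \<open>p ^ k \<ge> 1\<close> by (simp add: q mult.commute)
  finally show ?case .
qed simp

text \<open>
  Apply \<open>hop\<close> entrywise and use the Frobenius endomorphism.
\<close>

lemma hop_w_poly:
  assumes p: "prime p" "CHAR('k::comm_ring_1) = p"
  shows "hop p t (w_poly p k :: 'k mpoly)
    = det (mat k k (\<lambda>(a, b). \<Sum>u\<le>t. var u ^ p ^ a * cst (var (1 + b) ^ p ^ (a + u))))"
proof -
  interpret hop: comm_ring_hom "hop p t :: 'k mpoly \<Rightarrow> _" by (rule comm_ring_hom_hop)
  have "hop p t (var (1 + b) ^ p ^ a :: 'k mpoly) = (\<Sum>u\<le>t. var u ^ p ^ a * cst (var (1 + b) ^ p ^ (a + u)))" for a b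
    unfolding hop.hom_power hop_var linear_form_power_char[OF p]
    by (simp add: power_mult[symmetric] power_add[symmetric] add.commute)
  then have "map_mat (hop p t) (mat k k (\<lambda>(a, b). var (1 + b) ^ (p ^ a) :: 'k mpoly))
      = mat k k (\<lambda>(a, b). \<Sum>u\<le>t. var u ^ p ^ a * cst (var (1 + b) ^ p ^ (a + u)))"
    by (intro eq_matI) auto
  then show ?thesis
    unfolding w_poly_eq_moore moore_def hop.hom_det[symmetric] by simp
qed

text \<open>
  Level \<open>j\<close> works modulo the ideal of those \<open>x\<close> with \<open>x * Y j\<close> in \<open>null R\<close>, where \<open>Y j\<close> exhausts the variables
  before \<open>j\<close>. In row \<open>a\<close> the variable of index \<open>u\<close> occurs with exponent \<open>p ^ a\<close>, which is too large if
  \<open>a \<ge> k u\<close>. The inner variables that remain have exponents \<open>p ^ (a + u + h)\<close> with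
  \<open>a + u < j + k j\<close>, because the sizes decrease strictly. So the matrix is congruent to the product of a triangular matrix in the outer
  variables and a Moore matrix of size \<open>k j\<close>.
\<close>

lemma hop_w_powers_mod_null:
  fixes k :: "nat \<Rightarrow> nat"
  assumes p: "prime p" "CHAR('k::comm_ring_1) = p"
    and decreasing: "\<And>j u. j \<le> u \<Longrightarrow> u < M \<Longrightarrow> k u + (u - j) \<le> k j"
    and t: "M + h = Suc t"
    and R: "\<And>u. u < M \<Longrightarrow> lookup R (u + h) = p ^ k u - 1" "\<And>u. u < h \<or> M + h \<le> u \<Longrightarrow> lookup R u = 0"
  shows "(\<Prod>c<M. hop p t (w_poly p (k c) :: 'k mpoly) ^ (p - 1))
    - cst (\<Prod>c<M. (w_poly p (k c) ^ (p - 1)) ^ p ^ (c + h)) * (\<Prod>u<M. var (u + h) ^ (p ^ k u - 1)) \<in> null R"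
proof -
  have p0: "0 < p" using p(1) by (rule prime_gt_0_nat)
  note I = ring_ideal_null[of R, where 'a = "'k mpoly"]
  define W :: "nat \<Rightarrow> 'k mpoly mpoly" where "W c = hop p t (w_poly p (k c))" for c
  define Y :: "nat \<Rightarrow> 'k mpoly mpoly" where "Y j = (\<Prod>u<j. var (u + h) ^ (p ^ k u - 1))" for j
  define coef :: "nat \<Rightarrow> 'k mpoly" where "coef c = (w_poly p (k c) ^ (p - 1)) ^ p ^ (c + h)" for c
  have level: "(W j ^ (p - 1) - cst (coef j) * var (j + h) ^ (p ^ k j - 1)) * Y j \<in> null R" if j: "j < M" for j
  proof -
    define J where "J = {x. x * Y j \<in> null R}"
    have J: "ring_ideal J" unfolding J_def by (rule ring_ideal_colon[OF I])
    have used: "var u \<in> J" if "u < j + h" for u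
    proof (cases "u < h")
      case True
      then have "var u ^ 1 \<in> (null R :: 'k mpoly mpoly set)"
        using R(2) by (intro var_power_in_null) simp
      then show ?thesis using ring_idealD(4)[OF I] by (simp add: J_def)
    next
      case False
      define u' where "u' = u - h"
      have u': "u = u' + h" "u' < j" using False that by (auto simp: u'_def)
      have "var u ^ Suc (p ^ k u' - 1) \<in> (null R :: 'k mpoly mpoly set)"
        using R(1)[of u'] u' j by (intro var_power_in_null) simp
      from ring_idealD(4)[OF I this, of "\<Prod>v\<in>{..<j} - {u'}. var (v + h) ^ (p ^ k v - 1)"]
      show ?thesis
        using u' by (simp add: J_def Y_def prod.remove[of "{..<j}" u'] mult.assoc)
    qed
    have high: "var u ^ e \<in> J" if "lookup R u < e" for u e
      using ring_idealD(4)[OF I var_power_in_null[OF that]] by (simp add: J_def)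
    \<comment> \<open>Column \<open>i\<close> of \<open>T\<close> belongs to the inner exponent \<open>p ^ (i + j + h)\<close>, that is, to the outer variable
      of index \<open>i - a + (j + h)\<close> in row \<open>a\<close>.\<close>
    define T :: "nat \<Rightarrow> nat \<Rightarrow> 'k mpoly mpoly"
      where "T a i = (if a \<le> i then var (i - a + (j + h)) ^ p ^ a else 0)" for a i
    define X :: "nat \<Rightarrow> nat \<Rightarrow> 'k mpoly mpoly"
      where "X i b = cst ((var (1 + b) ^ p ^ i) ^ p ^ (j + h))" for i b
    define A where "A = mat (k j) (k j) (\<lambda>(a, b). \<Sum>u\<le>t. var u ^ p ^ a * cst (var (1 + b) ^ p ^ (a + u) :: 'k mpoly))"
    define B where "B = mat (k j) (k j) (\<lambda>(a, i). T a i) * mat (k j) (k j) (\<lambda>(i, b). X i b)"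
    have "det A - det B \<in> J"
    proof (rule ring_ideal_diff_det[OF J, of _ "k j"])
      fix a b assume ab: "a < k j" "b < k j"
      let ?g = "\<lambda>u. var u ^ p ^ a * cst (var (1 + b) ^ p ^ (a + u)) :: 'k mpoly mpoly"
      have "B $$ (a, b) = (\<Sum>i<k j. T a i * X i b)"
        using ab by (simp add: B_def scalar_prod_def atLeast0LessThan)
      also have "\<dots> = (\<Sum>i\<in>{a..<k j}. var (i - a + (j + h)) ^ p ^ a * X i b)"
        unfolding T_def by (intro sum.mono_neutral_cong_right) auto
      also have "\<dots> = (\<Sum>u\<in>{j + h..<k j - a + (j + h)}. ?g u)"
        using ab
        by (intro sum.reindex_bij_witness[of _ "\<lambda>u. u + a - (j + h)" "\<lambda>i. i - a + (j + h)"])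
          (auto simp: X_def power_mult[symmetric] power_add[symmetric] ac_simps)
      finally have B: "B $$ (a, b) = (\<Sum>u\<in>{j + h..<k j - a + (j + h)}. ?g u)" .
      \<comment> \<open>Terms that occur in only one of the two sums vanish modulo \<open>J\<close>: the variable is used up, or its
        exponent exceeds the one in \<open>R\<close>.\<close>
      have "(\<Sum>u\<le>t. ?g u) - (\<Sum>u\<in>{j + h..<k j - a + (j + h)}. ?g u) \<in> J"
      proof (rule ring_ideal_diff_sum[OF J])
        fix u assume u: "u \<in> {..t}" "u \<notin> {j + h..<k j - a + (j + h)}"
        show "?g u \<in> J"
        proof (cases "u < j + h")
          case True
          have "var u ^ p ^ a = (var u * var u ^ (p ^ a - 1) :: 'k mpoly mpoly)"
            using p0 by (simp flip: power_Suc)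
          then show ?thesis using ring_idealD(4)[OF J used[OF True]] by (simp add: mult.assoc)
        next
          case False
          define u' where "u' = u - h"
          have u': "u = u' + h" "u' < M" "j \<le> u'" "k j - a \<le> u' - j"
            using False u t by (auto simp: u'_def)
          then have "k u' \<le> a" using decreasing[of j u'] by linarith
          then have "p ^ k u' \<le> p ^ a" using p0 by (intro power_increasing) auto
          moreover have "0 < p ^ k u'" using p0 by simp
          ultimately have "lookup R u < p ^ a" using R(1)[OF u'(2)] unfolding u'(1) by linarith
          then show ?thesis by (intro ring_idealD(4)[OF J] high)
        qed
      next
        fix u assume u: "u \<notin> {..t}"
        have "lookup R u < p ^ a" using R(2)[of u] u t p0 by simp
        then show "?g u \<in> J" by (intro ring_idealD(4)[OF J] high)
      qed auto
      then show "A $$ (a, b) - B $$ (a, b) \<in> J" unfolding B using ab by (simp add: A_def)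
    next
      show "B \<in> carrier_mat (k j) (k j)"
        unfolding B_def by (rule mult_carrier_mat) (rule mat_carrier)+
    qed (simp add: A_def)
    moreover have "det A = W j"
      unfolding A_def W_def hop_w_poly[OF p] ..
    moreover have "det B = var (j + h) ^ (\<Sum>a<k j. p ^ a) * cst (w_poly p (k j) ^ p ^ (j + h))"
    proof -
      have "comm_ring_hom (\<lambda>x :: 'k mpoly. cst (x ^ p ^ (j + h)))"
      proof -
        interpret comm_ring_hom "\<lambda>x :: 'k mpoly. x ^ p ^ (j + h)"
          by (rule comm_ring_hom_frobenius) (simp_all add: p CHAR_mpoly)
        show ?thesis by unfold_locales (simp_all add: hom_add hom_mult cst_add cst_mult)
      qed
      then interpret \<phi>: comm_ring_hom "\<lambda>x :: 'k mpoly. cst (x ^ p ^ (j + h))" .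
      have "mat (k j) (k j) (\<lambda>(i, b). X i b)
          = map_mat (\<lambda>x. cst (x ^ p ^ (j + h))) (mat (k j) (k j) (\<lambda>(a, b). var (1 + b) ^ p ^ a))"
        by (rule eq_matI) (auto simp: X_def)
      then have "det (mat (k j) (k j) (\<lambda>(i, b). X i b)) = cst (w_poly p (k j) ^ p ^ (j + h))"
        by (simp only: \<phi>.hom_det w_poly_eq_moore moore_def)
      moreover have "det (mat (k j) (k j) (\<lambda>(a, i). T a i)) = var (j + h) ^ (\<Sum>a<k j. p ^ a)"
        by (subst det_upper_triangular_prod) (auto simp: T_def power_sum)
      ultimately show ?thesis
        unfolding B_def by (subst det_mult[of _ "k j"]) auto
    qed
    ultimately have "(W j - var (j + h) ^ (\<Sum>a<k j. p ^ a) * cst (w_poly p (k j) ^ p ^ (j + h))) * Y j \<in> null R"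
      by (simp add: J_def)
    from ring_ideal_diff_power[OF I this, of "p - 1"] show ?thesis
      by (simp only: power_mult_distrib power_mult[symmetric] trans[OF mult.commute repunit_eq[OF p0]] coef_def cst.hom_power mult_ac)
  qed
  have "(\<Prod>c<j. W c ^ (p - 1)) - cst (\<Prod>c<j. coef c) * Y j \<in> null R" if "j \<le> M" for j
    using that
  proof (induction j)
    case 0
    then show ?case using ring_idealD(1)[OF I] by (simp add: Y_def)
  next
    case (Suc j)
    then have IH: "(\<Prod>c<j. W c ^ (p - 1)) - cst (\<Prod>c<j. coef c) * Y j \<in> null R" and j: "j < M" by auto
    have 1: "(\<Prod>c<j. W c ^ (p - 1)) * W j ^ (p - 1) - cst (\<Prod>c<j. coef c) * Y j * W j ^ (p - 1) \<in> null R"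
      using ring_idealD(4)[OF I IH, of "W j ^ (p - 1)"] by (simp add: left_diff_distrib)
    have 2: "cst (\<Prod>c<j. coef c) * Y j * W j ^ (p - 1)
        - cst (\<Prod>c<j. coef c) * (cst (coef j) * var (j + h) ^ (p ^ k j - 1) * Y j) \<in> null R"
      using ring_idealD(3)[OF I level[OF j], of "cst (\<Prod>c<j. coef c)"]
      by (simp add: left_diff_distrib right_diff_distrib mult_ac)
    from ring_ideal_diff_trans[OF I 1 2] show ?case
      by (simp add: Y_def cst_mult mult_ac)
  qed
  from this[OF order.refl] show ?thesis by (simp add: W_def Y_def coef_def)
qed

section \<open>Diagrams of T-regular partitions\<close>

lemma downward_closed_eq_lessThan_card:
  fixes S :: "nat set"
  assumes "finite S" "\<And>i j. i \<le> j \<Longrightarrow> j \<in> S \<Longrightarrow> i \<in> S"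
  shows "S = {..<card S}"
proof -
  define m where "m = (LEAST i. i \<notin> S)"
  have "\<exists>i. i \<notin> S" using assms(1) infinite_UNIV_nat by (metis UNIV_I rev_finite_subset subsetI)
  then have m: "m \<notin> S" unfolding m_def by (rule LeastI_ex)
  have "S = {..<m}"
  proof (intro equalityI subsetI)
    show "x \<in> {..<m}" if "x \<in> S" for x
      using assms(2)[of m x] that m by (cases "m \<le> x") auto
    show "x \<in> S" if "x \<in> {..<m}" for x
      using not_less_Least[of x "\<lambda>i. i \<notin> S"] that by (auto simp: m_def)
  qed
  then show ?thesis by simp
qed

text \<open>
  A row of \<open>l\<close> boxes, where a box in the \<open>c\<close>th block of \<open>p - 1\<close> columns (counted from 0) contributes \<open>p\<^sup>c\<close>,
  adds up to the spike entry of \<open>l\<close>.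
\<close>

lemma sum_power_div_eq_mspike:
  assumes "2 \<le> p"
  shows "(\<Sum>x<l. p ^ (x div (p - 1))) = mspike p l"
proof (induction l rule: less_induct)
  case (less l)
  define q where "q = p - 1"
  have q: "0 < q" using assms by (simp add: q_def)
  show ?case
  proof (cases "l \<le> q")
    case True
    then have "(\<Sum>x<l. p ^ (x div (p - 1))) = (\<Sum>x<l. 1)"
      by (intro sum.cong) (auto simp: q_def)
    then show ?thesis using True by (simp add: mspike_small q_def)
  next
    case False
    define l' where "l' = l - q"
    have l: "l = q + l'" "0 < l'" using False by (auto simp: l'_def)
    have "(\<Sum>x<l. p ^ (x div q)) = (\<Sum>x<q. p ^ (x div q)) + (\<Sum>x<l'. p ^ ((q + x) div q))"
      using sum.atLeastLessThan_concat[of 0 q "l' + q" "\<lambda>x. p ^ (x div q)"]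
        sum.shift_bounds_nat_ivl[of "\<lambda>x. p ^ (x div q)" 0 q l']
      unfolding l(1) lessThan_atLeast0 by (simp only: add.commute[of _ q] add_0_left add_0_right le0 le_add1)
    also have "(\<Sum>x<q. p ^ (x div q)) = q" by simp
    also have "(\<Sum>x<l'. p ^ ((q + x) div q)) = p * (\<Sum>x<l'. p ^ (x div q))"
      using q by (simp add: sum_distrib_left)
    also have "(\<Sum>x<l'. p ^ (x div q)) = mspike p l'"
      using less[of l'] l q by (simp add: q_def)
    finally show ?thesis
      using mspike_shift[OF assms, of l'] l by (simp add: q_def add.commute)
  qed
qed

lemma map_upt_from_1: "map f [1..<n + 1] = map (\<lambda>i. f (Suc i)) [0..<n]"
proof -
  have "[1..<n + 1] = map Suc [0..<n]" by (simp add: map_Suc_upt del: upt_Suc)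
  then show ?thesis by (simp only: map_map o_def)
qed

lemma prod_list_map_upt: "prod_list (map f [0..<n]) = (\<Prod>i<n. f i :: 'a::comm_monoid_mult)"
  by (induction n) (simp_all add: mult.commute)

lemma prod_threshold: "b \<le> D \<Longrightarrow> (\<Prod>j<D. if j < b then x else y) = x ^ b * y ^ (D - b)"
  for x y :: "'a::comm_monoid_mult"
proof -
  assume "b \<le> D"
  then have "{..<D} \<inter> {j. j < b} = {..<b}" "{..<D} \<inter> - {j. j < b} = {b..<D}" by auto
  then show ?thesis by (simp add: prod.If_cases)
qed

locale T_regular_partition =
  fixes p :: nat and lam :: "nat list"
  assumes prime: "prime p" and nonempty: "lam \<noteq> []" and last: "last lam \<noteq> 0" and regular: "T_regular p lam"
begin

text \<open>
  Rows, columns and blocks are counted from 0. Row \<open>i\<close> has \<open>l i\<close> boxes, \<open>d i c\<close> of them in block \<open>c\<close>, and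
  \<open>height c\<close> is the length of the first column of block \<open>c\<close>. By T-regularity only the last nonempty row of a
  block can be incomplete, so the rows of block \<open>c\<close> have lengths \<open>q, \<dots>, q, d (height c - 1) c\<close>.
\<close>

definition "q = p - 1"
definition "n = length lam"
definition "l i = part lam (Suc i)"
definition "d i c = min q (l i - c * q)"
definition "height c = card {i. c * q < l i}"
definition "M = num_blocks p lam"

lemma p_ge_2: "2 \<le> p"
  using prime by (rule prime_ge_2_nat)

lemma q_pos: "0 < q" and p_eq: "p = Suc q"
  using p_ge_2 by (auto simp: q_def)

lemma n_pos: "0 < n"
  using nonempty by (simp add: n_def)

lemma l_beyond: "n \<le> i \<Longrightarrow> l i = 0"
  by (simp add: l_def n_def part_def)

lemma l_Suc: "l (Suc i) \<le> l i" and l_step: "l i \<le> l (Suc i) + q"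
proof -
  have "l (Suc i) \<le> l i \<and> l i \<le> l (Suc i) + q"
  proof (cases "i < n")
    case True
    then have "Suc i \<in> {1..length lam}" by (auto simp: n_def)
    with regular have "part lam (Suc i + 1) \<le> part lam (Suc i)" "part lam (Suc i) - part lam (Suc i + 1) \<le> p - 1"
      unfolding T_regular_def column_regular_def by blast+
    then show ?thesis by (auto simp: l_def q_def)
  qed (simp add: l_beyond)
  then show "l (Suc i) \<le> l i" "l i \<le> l (Suc i) + q" by auto
qed

lemma l_antimono: "i \<le> j \<Longrightarrow> l j \<le> l i"
  by (rule lift_Suc_antimono_le[of l]) (rule l_Suc)

lemma l_pos: "0 < l i \<longleftrightarrow> i < n"
proof -
  have "l (n - 1) = last lam"
    using nonempty n_pos by (auto simp: l_def part_def n_def last_conv_nth Suc_le_eq)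
  then have "0 < l i" if "i < n"
  proof -
    have "i \<le> n - 1" using that by simp
    then show ?thesis using l_antimono[of i "n - 1"] \<open>l (n - 1) = last lam\<close> last by simp
  qed
  then show ?thesis using l_beyond[of i] by (cases "i < n") auto
qed

text \<open>
  The last box of row \<open>i\<close> lies on the antidiagonal of number \<open>i * q + l i\<close>, counted from 1. Column
  \<open>p\<close>-regularity makes this number increase with \<open>i\<close>, so that the rows met by an antidiagonal are consecutive.
\<close>

lemma corner_mono: "i \<le> j \<Longrightarrow> i * q + l i \<le> j * q + l j"
proof (rule lift_Suc_mono_le[of "\<lambda>i. i * q + l i"])
  show "i * q + l i \<le> Suc i * q + l (Suc i)" for i using l_step[of i] by simp
qed

lemma less_height_iff: "i < height c \<longleftrightarrow> c * q < l i"
proof -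
  have "{i. c * q < l i} = {..<height c}"
    unfolding height_def
  proof (rule downward_closed_eq_lessThan_card)
    have "i < n" if "c * q < l i" for i
      using that l_pos[of i] by linarith
    then have "{i. c * q < l i} \<subseteq> {..<n}" by auto
    then show "finite {i. c * q < l i}" by (rule finite_subset) simp
    show "i \<in> {i. c * q < l i}" if "i \<le> j" "j \<in> {i. c * q < l i}" for i j
      using that l_antimono[of i j] by auto
  qed
  then show ?thesis by auto
qed

lemma height_le: "height c \<le> n"
  using less_height_iff[of n c] l_beyond[of n] by (simp add: not_less)

lemma block_eq: "block p lam (Suc c) = (SIGMA i:{1..n}. {c * q<..min (l (i - 1)) (Suc c * q)})"
  by (auto simp: block_def diagram_def q_def l_def n_def)

lemma min_shift: "min (l i) (Suc c * q) - c * q = d i c"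
  by (auto simp: d_def min_def)

lemma card_block: "card (block p lam (Suc c)) = (\<Sum>i<n. d i c)"
proof -
  have "card (block p lam (Suc c)) = (\<Sum>i\<in>{1..n}. min (l (i - 1)) (Suc c * q) - c * q)"
    unfolding block_eq by (subst card_SigmaI) (auto simp del: mult_Suc)
  then show ?thesis by (simp add: sum.atLeast1_atMost_eq min_shift del: mult_Suc)
qed

lemma block_nonempty_iff: "block p lam (Suc c) \<noteq> {} \<longleftrightarrow> c * q < l 0"
proof
  assume "block p lam (Suc c) \<noteq> {}"
  then obtain i j where "c * q < j" "j \<le> l i"
    unfolding block_eq by auto
  then show "c * q < l 0" using l_antimono[of 0 i] by simp
next
  assume "c * q < l 0"
  then have "(1, Suc (c * q)) \<in> block p lam (Suc c)"
    unfolding block_eq using n_pos q_pos by auto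
  then show "block p lam (Suc c) \<noteq> {}" by auto
qed

lemma less_M_iff: "c < M \<longleftrightarrow> c * q < l 0"
proof -
  have "{a. 1 \<le> a \<and> block p lam a \<noteq> {}} = Suc ` {c. c * q < l 0}"
    using block_nonempty_iff by (auto simp: image_iff Suc_le_eq dest!: gr0_implies_Suc)
  then have M: "M = card {c. c * q < l 0}"
    by (simp add: M_def num_blocks_def card_image)
  have "{c. c * q < l 0} = {..<M}"
    unfolding M
  proof (rule downward_closed_eq_lessThan_card)
    have "c < l 0" if "c * q < l 0" for c
    proof -
      have "c * 1 \<le> c * q" by (rule mult_le_mono2) (use q_pos in simp)
      then show ?thesis using that by linarith
    qed
    then have "{c. c * q < l 0} \<subseteq> {..<l 0}" by auto
    then show "finite {c. c * q < l 0}" by (rule finite_subset) simp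
    show "i \<in> {c. c * q < l 0}" if "i \<le> j" "j \<in> {c. c * q < l 0}" for i j
      using that by (auto intro: le_less_trans[OF mult_le_mono1])
  qed
  then show ?thesis by auto
qed

lemma height_pos: "c < M \<Longrightarrow> 0 < height c"
  by (simp add: less_height_iff less_M_iff)

lemma d_le: "d i c \<le> q"
  by (simp add: d_def)

text \<open>
  Otherwise row \<open>i\<close> and the last nonempty row of the block would both end strictly inside block \<open>c\<close>.
\<close>

lemma d_full:
  assumes "c < M" "i < height c - 1"
  shows "d i c = q"
proof (rule ccontr)
  assume "d i c \<noteq> q"
  define i' where "i' = height c - 1"
  have i': "i < i'" "i' < height c" using assms height_pos[of c] by (auto simp: i'_def)
  then have big: "c * q < l i" "c * q < l i'" by (simp_all flip: less_height_iff)
  have small: "l i < Suc c * q" using \<open>d i c \<noteq> q\<close> by (auto simp: d_def)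
  then have small': "l i' < Suc c * q" using l_antimono[of i i'] i' by simp
  have n: "i < n" "i' < n" using i' height_le[of c] by auto
  define X where "X = {i \<in> {1..length lam}. (Suc c - 1) * (p - 1) < part lam i \<and> part lam i < Suc c * (p - 1)}"
  have "card X \<le> 1" using regular unfolding T_regular_def X_def by auto
  moreover have "{Suc i, Suc i'} \<subseteq> X"
    using big small small' n by (auto simp: X_def l_def n_def q_def)
  moreover have "finite X" by (simp add: X_def)
  ultimately have "card {Suc i, Suc i'} \<le> 1" by (meson card_mono le_trans)
  then show False using i' by simp
qed

lemma d_empty: "height c - 1 < i \<Longrightarrow> d i c = 0"
  using less_height_iff[of i c] by (auto simp: d_def not_less)

lemma mspike_l: "mspike p (l i) = (\<Sum>c<M. d i c * p ^ c)"
proof -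
  have "l i \<le> M * q" using less_M_iff[of M] l_antimono[of 0 i] by simp
  then show ?thesis using mspike_eq_sum_digits[OF p_ge_2, of "l i" M] by (simp add: d_def q_def)
qed

lemma block_partition_eq: "block_partition p lam (Suc c) = map (\<lambda>i. d i c) [0..<n]"
proof -
  have "{j. (Suc i, j) \<in> block p lam (Suc c)} = {c * q<..min (l i) (Suc c * q)}" if "i < n" for i
    unfolding block_eq using that by auto
  then have "card {j. (Suc i, j) \<in> block p lam (Suc c)} = d i c" if "i < n" for i
    using that by (simp add: min_shift del: mult_Suc)
  then show ?thesis
    unfolding block_partition_def map_upt_from_1 by (simp add: n_def)
qed

lemma w_prod_eq: "w_prod p (conj_partition \<mu>)
  = (\<Prod>j<part \<mu> 1. w_poly p (card {i. i < length \<mu> \<and> j < \<mu> ! i}) :: 'k::comm_ring_1 mpoly)"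
proof -
  have "{i. (i, Suc j) \<in> diagram \<mu>} = Suc ` {i. i < length \<mu> \<and> j < \<mu> ! i}" for j
    by (auto simp: diagram_def part_def image_iff Suc_le_eq dest!: gr0_implies_Suc)
  then have "card {i. (i, Suc j) \<in> diagram \<mu>} = card {i. i < length \<mu> \<and> j < \<mu> ! i}" for j
    by (simp add: card_image)
  then have "map (w_poly p :: nat \<Rightarrow> 'k mpoly) (conj_partition \<mu>) = map (\<lambda>j. w_poly p (card {i. i < length \<mu> \<and> j < \<mu> ! i})) [0..<part \<mu> 1]"
    unfolding conj_partition_def map_upt_from_1 by simp
  then show ?thesis
    unfolding w_prod_def by (simp add: prod_list_map_upt)
qed

text \<open>
  With \<open>f = height c - 1\<close> full rows and one row of \<open>b\<close> boxes, block \<open>c\<close> has \<open>b\<close> columns of length \<open>f + 1\<close> and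
  \<open>q - b\<close> columns of length \<open>f\<close>. If \<open>f = 0\<close> the latter are missing, which is harmless as \<open>w(0) = 1\<close>.
\<close>

lemma w_prod_block:
  assumes c: "c < M"
  shows "w_prod p (conj_partition (block_partition p lam (Suc c)))
    = w_poly p (height c) ^ d (height c - 1) c * w_poly p (height c - 1) ^ (q - d (height c - 1) c)"
proof -
  define f where "f = height c - 1"
  have f: "height c = Suc f" using height_pos[OF c] by (simp add: f_def)
  have fn: "f < n" using height_le[of c] f by simp
  define b where "b = d f c"
  have b: "b \<le> q" by (simp add: b_def d_le)
  have D: "part (block_partition p lam (Suc c)) 1 = d 0 c"
    using n_pos by (simp add: block_partition_eq part_def)
  have count: "card {i. i < length (block_partition p lam (Suc c)) \<and> j < block_partition p lam (Suc c) ! i}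
      = (if j < b then Suc f else f)" if "j < d 0 c" for j
  proof -
    have jq: "j < q" using that d_le[of 0 c] by simp
    have "{i. i < length (block_partition p lam (Suc c)) \<and> j < block_partition p lam (Suc c) ! i} = {i. i < n \<and> j < d i c}"
      by (auto simp: block_partition_eq)
    also have "\<dots> = {..<if j < b then Suc f else f}"
    proof (intro equalityI subsetI)
      fix i assume "i \<in> {i. i < n \<and> j < d i c}"
      then have i: "i < n" "j < d i c" by auto
      then have "\<not> f < i" using d_empty[of c i] by (auto simp: f_def)
      then show "i \<in> {..<if j < b then Suc f else f}"
        using i by (cases "i = f") (auto simp: b_def)
    next
      fix i assume "i \<in> {..<if j < b then Suc f else f}"
      then have "i < f \<or> (i = f \<and> j < b)" by (auto simp: less_Suc_eq split: if_splits)
      then show "i \<in> {i. i < n \<and> j < d i c}"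
        using d_full[OF c, of i] fn jq by (auto simp: f_def b_def)
    qed
    finally show ?thesis by simp
  qed
  have "w_prod p (conj_partition (block_partition p lam (Suc c)))
      = (\<Prod>j<d 0 c. if j < b then w_poly p (Suc f) else w_poly p f)"
    unfolding w_prod_eq D by (intro prod.cong refl) (simp add: count)
  also have "\<dots> = w_poly p (Suc f) ^ b * w_poly p f ^ (q - b)"
  proof (cases "f = 0")
    case True
    then show ?thesis by (simp add: b_def w_poly_eq_moore[of _ 0] moore_def)
  next
    case False
    then have "d 0 c = q" using d_full[OF c, of 0] by (simp add: f_def)
    then show ?thesis using b by (simp add: prod_threshold)
  qed
  finally show ?thesis by (simp add: f b_def)
qed

lemma p_poly_eq:
  "p_poly p lam = (\<Prod>c<M. (w_poly p (height c) ^ d (height c - 1) c * w_poly p (height c - 1) ^ (q - d (height c - 1) c)) ^ p ^ c)"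
proof -
  have "p_poly p lam = (\<Prod>c<M. w_prod p (conj_partition (block_partition p lam (Suc c))) ^ p ^ c)"
    unfolding p_poly_def M_def[symmetric]
    by (rule prod.reindex_bij_witness[of _ Suc "\<lambda>j. j - 1"]) auto
  then show ?thesis by (simp add: w_prod_block)
qed

end

section \<open>Milnor spikes as coefficients of the homogenized operation\<close>

text \<open>
  For \<open>h = 0\<close> the first spike entry becomes the exponent of \<open>var 0\<close>, since the entries of \<open>tl xs\<close> fall short of
  the degree by exactly this number. For \<open>h = 1\<close> the entries of \<open>xs\<close> already exhaust the degree.
\<close>

lemma milnor_spike_eq_lookup:
  fixes f :: "'k::comm_ring_1 mpoly"
  assumes xs: "\<And>i. i < length xs \<Longrightarrow> 0 < xs ! i" "xs \<noteq> []" and h: "h \<le> 1"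
    and f: "homog (\<Sum>i<length xs. mspike p (part xs (Suc i))) f"
  shows "milnor_spike p (drop (1 - h) xs) f
    = lookup (hop p (length xs - 1 + h) f) (spike_key p (length xs) (\<lambda>i. part xs (Suc i)) h)"
proof -
  define n where "n = length xs"
  define t where "t = n - 1 + h"
  define R where "R = map (spike_entry p) (drop (1 - h) xs)"
  define \<rho> where "\<rho> u = (if h \<le> u then mspike p (part xs (Suc (u - h))) else 0)" for u
  have n: "0 < n" using xs(2) by (simp add: n_def)
  have len: "length R = t" using n h by (auto simp: R_def t_def n_def le_Suc_eq)
  have reindex: "(\<Sum>u\<le>t. g u (\<rho> u)) = (\<Sum>i<n. g (i + h) (mspike p (part xs (Suc i))))"
    if "\<And>u. g u 0 = 0" for g :: "nat \<Rightarrow> nat \<Rightarrow> 'z::comm_monoid_add"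
  proof -
    have "(\<Sum>u\<le>t. g u (\<rho> u)) = (\<Sum>u\<in>{h..<n + h}. g u (\<rho> u))"
      using n that by (intro sum.mono_neutral_right) (auto simp: t_def \<rho>_def)
    also have "\<dots> = (\<Sum>i<n. g (i + h) (\<rho> (i + h)))"
      using sum.shift_bounds_nat_ivl[of "\<lambda>u. g u (\<rho> u)" 0 h n] by (simp add: lessThan_atLeast0)
    finally show ?thesis by (simp add: \<rho>_def)
  qed
  have "milnor p R f = lookup (hop p (length R) f) (\<Sum>u\<le>length R. single u (\<rho> u))"
  proof (rule milnor_eq_lookup_hop[OF f])
    show "(\<Sum>u\<le>length R. \<rho> u) = (\<Sum>i<length xs. mspike p (part xs (Suc i)))"
      using reindex[of "\<lambda>_ x. x"] by (simp add: len n_def)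
    show "\<rho> u = part R u" if u: "1 \<le> u" "u \<le> length R" for u
    proof -
      have idx: "u - h < n" "h \<le> u" "1 - h + (u - 1) = u - h" using u h n unfolding len t_def by auto
      then have "0 < xs ! (u - h)" using xs(1) by (simp add: n_def)
      moreover have "part R u = spike_entry p (xs ! (u - h))"
        using u idx by (simp add: part_def) (simp add: R_def)
      ultimately show ?thesis using idx by (simp add: \<rho>_def part_def mspike_def n_def)
    qed
  qed
  moreover have "(\<Sum>u\<le>t. single u (\<rho> u)) = spike_key p n (\<lambda>i. part xs (Suc i)) h"
    using reindex[of single] by (simp add: spike_key_def)
  ultimately show ?thesis
    unfolding milnor_spike_def R_def[symmetric] n_def[symmetric] t_def[symmetric] len by simp
qed

context T_regular_partition
begin

lemma lam_pos: "i < length lam \<Longrightarrow> 0 < lam ! i"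
  using l_pos[of i] by (simp add: l_def part_def n_def)

lemma milnor_spike_lam:
  assumes "h \<le> 1" "homog (\<Sum>i<n. mspike p (l i)) f"
  shows "milnor_spike p (drop (1 - h) lam) f = lookup (hop p (n - 1 + h) f) (spike_key p n l h)"
proof -
  have l: "(\<lambda>i. part lam (Suc i)) = l" by (rule ext) (simp add: l_def)
  show ?thesis
    using milnor_spike_eq_lookup[of lam h p f] lam_pos nonempty assms unfolding l l_def[symmetric] n_def by simp
qed

section \<open>The spike monomial\<close>

text \<open>
  The entry of the matrix of linear forms is \<open>x\<^sub>i\<^bsup>p^(u+h)\<^esup>\<close>, so its minors are \<open>w(k)\<^bsup>p^h\<^esup>\<close>. For \<open>h = 1\<close> the
  variable \<open>var 0\<close> must be dropped from the forms first; it lies in the null ideal, as its exponent in the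
  target monomial is 0.
\<close>

lemma lookup_hop_spike_monomial:
  assumes k: "CHAR('k::idom) = p" and h: "h \<le> 1"
  shows "lookup (hop p (n - 1 + h) (single (spike_key p n l 1) 1 :: 'k mpoly)) (spike_key p n l h)
    = p_poly p lam ^ p ^ h"
proof -
  let ?R = "spike_key p n l h"
  define t where "t = n - 1 + h"
  define m :: "nat \<Rightarrow> nat \<Rightarrow> 'k mpoly" where "m i u = var (Suc i) ^ p ^ (u + h)" for i u
  define L where "L i = (\<Sum>u\<le>t. var u * cst (var (Suc i) ^ p ^ u) :: 'k mpoly mpoly)" for i
  define L' where "L' i = (\<Sum>u<n. var (u + h) * cst (m i u))" for i
  note I = ring_ideal_null[of ?R, where 'a = "'k mpoly"]
  have R: "lookup ?R (u + h) = mspike p (l u)" if "u < n" for u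
    using that by (simp add: lookup_spike_key)
  have "hop p t (single (spike_key p n l 1) 1 :: 'k mpoly)
      = (\<Prod>j\<in>Suc ` {..<n}. (\<Sum>u\<le>t. var u * cst (var j ^ p ^ u)) ^ lookup (spike_key p n l 1) j)"
    unfolding hop_single using keys_spike_key[of p n l 1]
    by (subst monom_eval_superset) simp_all
  also have "\<dots> = (\<Prod>i<n. L i ^ mspike p (l i))"
    by (simp add: prod.reindex L_def lookup_spike_key)
  finally have hop: "hop p t (single (spike_key p n l 1) 1 :: 'k mpoly) = (\<Prod>i<n. L i ^ mspike p (l i))" .
  have "L i - L' i \<in> null ?R" for i
  proof -
    let ?g = "\<lambda>u. var u * cst (var (Suc i) ^ p ^ u) :: 'k mpoly mpoly"
    have "L' i = (\<Sum>u\<in>{h..<n + h}. ?g u)"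
      using sum.shift_bounds_nat_ivl[of ?g 0 h n] by (simp add: L'_def m_def lessThan_atLeast0)
    moreover have "L i - (\<Sum>u\<in>{h..<n + h}. ?g u) \<in> null ?R"
      unfolding L_def
    proof (rule ring_ideal_diff_sum[OF I])
      fix u assume "u \<in> {..t}" "u \<notin> {h..<n + h}"
      then have "lookup ?R u < 1" by (auto simp: lookup_spike_key)
      from var_power_in_null[OF this] have "var u \<in> (null ?R :: 'k mpoly mpoly set)" by simp
      then show "?g u \<in> null ?R" by (rule ring_idealD(4)[OF I])
    next
      fix u assume "u \<in> {h..<n + h}" "u \<notin> {..t}"
      then show "?g u \<in> null ?R" using n_pos by (auto simp: t_def)
    qed auto
    ultimately show ?thesis by simp
  qed
  then have 1: "(\<Prod>i<n. L i ^ mspike p (l i)) - (\<Prod>i<n. L' i ^ mspike p (l i)) \<in> null ?R"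
    using ring_ideal_diff_power[OF I, of "L i" "L' i" 1 for i]
    by (intro ring_ideal_diff_prod[OF I]) simp
  have minor_m: "minor m j = w_poly p j ^ p ^ h" for j
  proof -
    have "minor (\<lambda>i u. (var (Suc i) ^ p ^ u) ^ p ^ h) j = (w_poly p j :: 'k mpoly) ^ p ^ h"
      using minor_hom[OF comm_ring_hom_frobenius[OF prime], of "\<lambda>i u. var (Suc i) ^ p ^ u :: 'k mpoly" h j] k
      by (simp add: minor_eq_w_poly CHAR_mpoly)
    moreover have "m = (\<lambda>i u. (var (Suc i) ^ p ^ u) ^ p ^ h)"
      by (intro ext) (simp add: m_def power_add power_mult)
    ultimately show ?thesis by simp
  qed
  define C where "C = (\<Prod>c<M. (minor m (Suc (height c - 1)) ^ d (height c - 1) c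
      * minor m (height c - 1) ^ (p - 1 - d (height c - 1) c)) ^ p ^ c)"
  have 2: "(\<Prod>i<n. L' i ^ mspike p (l i)) - cst C * (\<Prod>u<n. var (u + h) ^ mspike p (l u)) \<in> null ?R"
    unfolding L'_def mspike_l C_def
  proof (rule staircase_product_mod_null[OF prime k])
    show "height c - 1 < n" if "c < M" for c
      using height_pos[OF that] height_le[of c] by simp
    show "d u c = p - 1" if "c < M" "u < height c - 1" for c u
      using d_full[OF that] by (simp add: q_def)
    show "d u c = 0" if "height c - 1 < u" for c u
      using that by (rule d_empty)
    show "d u c \<le> p - 1" for u c using d_le by (simp add: q_def)
    show "minor m j \<noteq> 0" for j using w_poly_nonzero[OF p_ge_2, where 'k = 'k] by (simp add: minor_m)
    show "lookup ?R (u + h) = (\<Sum>c<M. d u c * p ^ c)" if "u < n" for u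
      using R[OF that] by (simp add: mspike_l)
  qed
  have "(\<Prod>u<n. var (u + h) ^ mspike p (l u)) = (single ?R 1 :: 'k mpoly mpoly)"
    by (simp add: var_power prod_single spike_key_def)
  then have "lookup (hop p t (single (spike_key p n l 1) 1 :: 'k mpoly)) ?R = lookup (cst C * single ?R 1) ?R"
    unfolding hop using lookup_eq_of_null[OF ring_ideal_diff_trans[OF I 1 2]] by simp
  also have "\<dots> = C" by (simp add: cst_mult_single)
  also have "C = p_poly p lam ^ p ^ h"
  proof -
    have "C = (\<Prod>c<M. ((w_poly p (height c) ^ d (height c - 1) c * w_poly p (height c - 1) ^ (q - d (height c - 1) c)) ^ p ^ c) ^ p ^ h)"
      unfolding C_def
    proof (rule prod.cong[OF refl])
      fix c assume "c \<in> {..<M}"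
      then have "Suc (height c - 1) = height c" using height_pos[of c] by simp
      then show "(minor m (Suc (height c - 1)) ^ d (height c - 1) c * minor m (height c - 1) ^ (p - 1 - d (height c - 1) c)) ^ p ^ c
        = ((w_poly p (height c) ^ d (height c - 1) c * w_poly p (height c - 1) ^ (q - d (height c - 1) c)) ^ p ^ c) ^ p ^ h"
        by (simp only: minor_m q_def[symmetric] power_mult_distrib power_mult[symmetric] mult_ac)
    qed
    then show ?thesis by (simp add: p_poly_eq prod_power_distrib)
  qed
  finally show ?thesis by (simp add: t_def)
qed

end

section \<open>Antidiagonals\<close>

lemma sum_single_same: "(\<Sum>x\<in>A. single k (f x)) = single k (\<Sum>x\<in>A. f x :: nat)"
  by (induction A rule: infinite_finite_induct) (simp_all add: single_add)

lemma minus_one_powi: "(-1 :: 'a::field) powi e = (if even e then 1 else -1)"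
  by (simp add: power_int_minus_left)

text \<open>
  Only the parity of \<open>\<epsilon>(\<lambda>)\<close> matters, so its alternating signs can be ignored.
\<close>

lemma even_alternating_sum:
  "even (\<Sum>j\<in>A. (-1) ^ k j * int (x j)) \<longleftrightarrow> even (\<Sum>j\<in>A. x j)"
  by (induction A rule: infinite_finite_induct) (auto simp: even_add)

lemma card_eq_sum_of_bool: "finite A \<Longrightarrow> card {x \<in> A. P x} = (\<Sum>x\<in>A. of_bool (P x))"
  by (simp add: Int_def)

context T_regular_partition
begin

text \<open>
  Antidiagonal \<open>\<kappa> + 1\<close> passes through row \<open>i\<close> at column \<open>\<kappa> - i * q\<close> (counted from 0). As each step down moves
  \<open>q\<close> columns to the left, it meets every block at most once, and its lowest box lies in block 0 and row
  \<open>\<kappa> div q\<close>.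
\<close>

definition "diag_rows \<kappa> = {i. i * q \<le> \<kappa> \<and> \<kappa> < i * q + l i}"
definition "top_row \<kappa> = Min (diag_rows \<kappa>)"
definition "diag_len \<kappa> = card (diag_rows \<kappa>)"
definition "num_diags = (n - 1) * q + l (n - 1)"

lemma height_0: "height 0 = n"
proof (rule antisym[OF height_le])
  have "\<not> 0 * q < l (height 0)" using less_height_iff[of "height 0" 0] by blast
  then have "\<not> 0 < l (height 0)" by (simp only: mult_0) simp
  then show "n \<le> height 0" unfolding l_pos by linarith
qed

lemma M_pos: "0 < M"
  using less_M_iff[of 0] l_pos[of 0] n_pos by simp

lemma part_T_conjugate: "c < M \<Longrightarrow> part (T_conjugate p lam) (Suc c) = (\<Sum>i<n. d i c)"
  unfolding T_conjugate_def map_upt_from_1 M_def[symmetric] by (simp add: part_def card_block)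

lemma l_le_q_last: "l (n - 1) \<le> q"
  using l_step[of "n - 1"] l_beyond[of n] n_pos by simp

lemma l_full: "i < n - 1 \<Longrightarrow> q \<le> l i"
  using d_full[of 0 i] M_pos height_0 by (simp add: d_def min_def split: if_splits)

lemma part_T_conjugate_1: "part (T_conjugate p lam) 1 = num_diags"
proof -
  have n: "{..<n} = insert (n - 1) {..<n - 1}" using n_pos by auto
  have "(\<Sum>i<n. d i 0) = d (n - 1) 0 + (\<Sum>i<n - 1. d i 0)" by (subst n) simp
  also have "(\<Sum>i<n - 1. d i 0) = (\<Sum>i<n - 1. q)"
    using l_full by (intro sum.cong) (auto simp: d_def min_def)
  also have "d (n - 1) 0 = l (n - 1)" using l_le_q_last by (simp add: d_def)
  finally show ?thesis using part_T_conjugate[OF M_pos] by (simp add: num_diags_def)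
qed

lemma diag_rows_le: "i \<in> diag_rows \<kappa> \<Longrightarrow> i \<le> \<kappa> div q"
  using q_pos by (simp add: diag_rows_def less_eq_div_iff_mult_less_eq)

lemma diag_rows_less_n: "i \<in> diag_rows \<kappa> \<Longrightarrow> i < n"
  using l_pos[of i] by (auto simp: diag_rows_def)

lemma finite_diag_rows: "finite (diag_rows \<kappa>)"
  by (rule finite_subset[of _ "{..<n}"]) (use diag_rows_less_n in auto)

lemma bottom_in_diag_rows:
  assumes "\<kappa> < num_diags"
  shows "\<kappa> div q \<in> diag_rows \<kappa>"
proof -
  define i where "i = \<kappa> div q"
  have \<kappa>: "i * q \<le> \<kappa>" "\<kappa> < i * q + q"
    using q_pos dividend_less_div_times[of q \<kappa>] by (simp_all add: i_def add.commute)
  have "\<kappa> < n * q" using assms l_le_q_last n_pos by (cases n) (auto simp: num_diags_def)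
  then have "i < n" using q_pos by (simp add: i_def less_mult_imp_div_less)
  then consider "i < n - 1" | "i = n - 1" by linarith
  then have "\<kappa> < i * q + l i"
  proof cases
    case 1
    then show ?thesis using l_full[of i] \<kappa> by simp
  next
    case 2
    then show ?thesis using assms by (simp add: num_diags_def)
  qed
  then show ?thesis using \<kappa> by (simp add: diag_rows_def i_def)
qed

lemma diag_rows_eq:
  assumes "\<kappa> < num_diags"
  shows "diag_rows \<kappa> = {top_row \<kappa>..\<kappa> div q}" and diag_len_eq: "Suc (\<kappa> div q) = top_row \<kappa> + diag_len \<kappa>"
    and "top_row \<kappa> \<le> \<kappa> div q"
proof -
  have ne: "diag_rows \<kappa> \<noteq> {}" using bottom_in_diag_rows[OF assms] by auto
  have top: "top_row \<kappa> \<in> diag_rows \<kappa>" unfolding top_row_def by (rule Min_in[OF finite_diag_rows ne])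
  have up: "i \<in> diag_rows \<kappa>" if "top_row \<kappa> \<le> i" "i \<le> \<kappa> div q" for i
  proof -
    have "top_row \<kappa> * q + l (top_row \<kappa>) \<le> i * q + l i" using that(1) by (rule corner_mono)
    moreover have "\<kappa> < top_row \<kappa> * q + l (top_row \<kappa>)" using top unfolding diag_rows_def by blast
    moreover have "i * q \<le> \<kappa> div q * q" using that(2) by (rule mult_le_mono1)
    moreover have "\<kappa> div q * q \<le> \<kappa>" by (rule div_times_less_eq_dividend)
    ultimately show ?thesis unfolding diag_rows_def mem_Collect_eq by linarith
  qed
  have low: "top_row \<kappa> \<le> i" if "i \<in> diag_rows \<kappa>" for i
    unfolding top_row_def using finite_diag_rows that by (rule Min_le)
  show eq: "diag_rows \<kappa> = {top_row \<kappa>..\<kappa> div q}"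
  proof (intro equalityI subsetI)
    show "i \<in> {top_row \<kappa>..\<kappa> div q}" if "i \<in> diag_rows \<kappa>" for i
      using low[OF that] diag_rows_le[OF that] by simp
    show "i \<in> diag_rows \<kappa>" if "i \<in> {top_row \<kappa>..\<kappa> div q}" for i
      using that by (intro up) simp_all
  qed
  show le: "top_row \<kappa> \<le> \<kappa> div q" using top by (rule diag_rows_le)
  have "diag_len \<kappa> = Suc (\<kappa> div q) - top_row \<kappa>" unfolding diag_len_def eq by simp
  then show "Suc (\<kappa> div q) = top_row \<kappa> + diag_len \<kappa>" using le by linarith
qed

lemma diag_rows_interval: "\<kappa> < num_diags \<Longrightarrow> {top_row \<kappa>..<top_row \<kappa> + diag_len \<kappa>} = diag_rows \<kappa>"
  using diag_rows_eq(1) diag_len_eq by (metis atLeastLessThanSuc_atLeastAtMost)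

lemma diagonals_through_row:
  assumes "i < n"
  shows "{\<kappa> \<in> {..<num_diags}. i \<in> diag_rows \<kappa>} = {i * q..<i * q + l i}"
proof -
  have "i * q + l i \<le> num_diags" unfolding num_diags_def using assms by (intro corner_mono) simp
  then show ?thesis by (auto simp: diag_rows_def)
qed

lemma antidiagonal_eq: "antidiagonal p lam (Suc \<kappa>) = (\<lambda>i. (Suc i, Suc (\<kappa> - i * q))) ` diag_rows \<kappa>"
proof -
  have "(i, j) \<in> antidiagonal p lam (Suc \<kappa>)
      \<longleftrightarrow> (\<exists>i'. i = Suc i' \<and> i' \<in> diag_rows \<kappa> \<and> j = Suc (\<kappa> - i' * q))" for i j
  proof (cases i)
    case (Suc i')
    have "j + Suc i' * (p - 1) = Suc \<kappa> + p - 1 \<longleftrightarrow> j + i' * q = Suc \<kappa>"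
    proof -
      have "Suc i' * (p - 1) = q + i' * q" by (simp add: q_def)
      moreover have "Suc \<kappa> + p - 1 = Suc \<kappa> + q" using p_eq by linarith
      ultimately show ?thesis by linarith
    qed
    then show ?thesis
      using l_pos[of i'] unfolding antidiagonal_def diagram_def diag_rows_def Suc
      by (auto simp: l_def n_def simp del: mult_Suc)
  qed (simp add: antidiagonal_def diagram_def)
  then show ?thesis by auto
qed

lemma v_factor_eq:
  assumes "\<kappa> < num_diags"
  shows "v_factor p lam (Suc \<kappa>) = moore p (Suc (top_row \<kappa>)) (diag_len \<kappa>)"
proof -
  have fst: "fst ` antidiagonal p lam (Suc \<kappa>) = {Suc (top_row \<kappa>)..Suc (\<kappa> div q)}"
    unfolding antidiagonal_eq image_image fst_conv diag_rows_eq(1)[OF assms] by (rule image_Suc_atLeastAtMost)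
  have "Max {Suc (top_row \<kappa>)..Suc (\<kappa> div q)} = Suc (\<kappa> div q)"
    "Min {Suc (top_row \<kappa>)..Suc (\<kappa> div q)} = Suc (top_row \<kappa>)"
    using diag_rows_eq(3)[OF assms] by (auto intro: Max_eqI Min_eqI)
  moreover have "Suc (\<kappa> div q) - Suc (top_row \<kappa>) + 1 = diag_len \<kappa>"
    using diag_len_eq[OF assms] diag_rows_eq(3)[OF assms] by linarith
  ultimately show ?thesis
    unfolding v_factor_def fst Let_def by (simp only: bracket_eq_moore)
qed

lemma v_poly_eq: "v_poly p lam = (\<Prod>\<kappa><num_diags. moore p (Suc (top_row \<kappa>)) (diag_len \<kappa>))"
  unfolding v_poly_def part_T_conjugate_1
  by (simp add: prod.atLeast1_atMost_eq v_factor_eq)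

text \<open>
  A box of antidiagonal \<open>\<kappa> + 1\<close> in row \<open>i\<close> contributes \<open>p\<^sup>c\<close> to the exponent of \<open>x\<^bsub>i+1\<^esub>\<close> in the leading monomial,
  where \<open>c = \<kappa> div q - i\<close> is the number of boxes below it, that is, the number of its block. Sorting the boxes by
  rows gives the spike entries.
\<close>

lemma lead_exponent_eq:
  "(\<Sum>\<kappa><num_diags. \<Sum>a<diag_len \<kappa>. single (Suc (top_row \<kappa>) + a) (p ^ (diag_len \<kappa> - 1 - a))) = spike_key p n l 1"
proof -
  have "(\<Sum>\<kappa><num_diags. \<Sum>a<diag_len \<kappa>. single (Suc (top_row \<kappa>) + a) (p ^ (diag_len \<kappa> - 1 - a)))
      = (\<Sum>\<kappa><num_diags. \<Sum>i\<in>diag_rows \<kappa>. single (Suc i) (p ^ (\<kappa> div q - i)))"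
  proof (rule sum.cong[OF refl])
    fix \<kappa> assume "\<kappa> \<in> {..<num_diags}"
    then have \<kappa>: "\<kappa> < num_diags" by simp
    show "(\<Sum>a<diag_len \<kappa>. single (Suc (top_row \<kappa>) + a) (p ^ (diag_len \<kappa> - 1 - a)))
        = (\<Sum>i\<in>diag_rows \<kappa>. single (Suc i) (p ^ (\<kappa> div q - i)))"
      unfolding diag_rows_interval[OF \<kappa>, symmetric] using diag_len_eq[OF \<kappa>]
      by (intro sum.reindex_bij_witness[of _ "\<lambda>i. i - top_row \<kappa>" "\<lambda>a. a + top_row \<kappa>"])
        (auto simp: add.commute intro!: arg_cong[of _ _ "\<lambda>x. single _ (p ^ x)"])
  qed
  also have "\<dots> = (\<Sum>\<kappa><num_diags. \<Sum>i\<in>{i \<in> {..<n}. i \<in> diag_rows \<kappa>}. single (Suc i) (p ^ (\<kappa> div q - i)))"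
    using diag_rows_less_n by (intro sum.cong) auto
  also have "\<dots> = (\<Sum>i<n. \<Sum>\<kappa>\<in>{\<kappa> \<in> {..<num_diags}. i \<in> diag_rows \<kappa>}. single (Suc i) (p ^ (\<kappa> div q - i)))"
    by (rule sum.swap_restrict) simp_all
  also have "\<dots> = (\<Sum>i<n. single (Suc i) (mspike p (l i)))"
  proof (rule sum.cong[OF refl])
    fix i assume "i \<in> {..<n}"
    then have i: "i < n" by simp
    have "(\<Sum>\<kappa>\<in>{\<kappa> \<in> {..<num_diags}. i \<in> diag_rows \<kappa>}. single (Suc i) (p ^ (\<kappa> div q - i)))
        = single (Suc i) (\<Sum>\<kappa>\<in>{i * q..<i * q + l i}. p ^ (\<kappa> div q - i))"
      unfolding diagonals_through_row[OF i] by (rule sum_single_same)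
    also have "(\<Sum>\<kappa>\<in>{i * q..<i * q + l i}. p ^ (\<kappa> div q - i)) = (\<Sum>x<l i. p ^ (x div q))"
      using sum.shift_bounds_nat_ivl[of "\<lambda>\<kappa>. p ^ (\<kappa> div q - i)" 0 "i * q" "l i"] q_pos
      by (simp add: lessThan_atLeast0 add.commute)
    also have "\<dots> = mspike p (l i)"
      using sum_power_div_eq_mspike[OF p_ge_2, of "l i"] by (simp add: q_def)
    finally show "(\<Sum>\<kappa>\<in>{\<kappa> \<in> {..<num_diags}. i \<in> diag_rows \<kappa>}. single (Suc i) (p ^ (\<kappa> div q - i)))
        = single (Suc i) (mspike p (l i))" .
  qed
  finally show ?thesis by (simp add: spike_key_def)
qed

lemma diag_len_le_M:
  assumes "\<kappa> < num_diags"
  shows "diag_len \<kappa> \<le> M"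
proof -
  have "top_row \<kappa> \<in> diag_rows \<kappa>" using diag_rows_eq[OF assms] by auto
  then have "\<kappa> < top_row \<kappa> * q + l 0" using l_antimono[of 0 "top_row \<kappa>"] by (simp add: diag_rows_def)
  moreover have "\<kappa> div q * q \<le> \<kappa>" by simp
  moreover have "\<kappa> div q = top_row \<kappa> + (diag_len \<kappa> - 1)" using diag_len_eq[OF assms] diag_rows_eq(3)[OF assms] by simp
  ultimately have "(diag_len \<kappa> - 1) * q < l 0" by (simp add: add_mult_distrib)
  then show ?thesis using less_M_iff[of "diag_len \<kappa> - 1"] by simp
qed

lemma div_q_eq_iff: "\<kappa> div q = m \<longleftrightarrow> m * q \<le> \<kappa> \<and> \<kappa> < m * q + q"
proof
  show "m * q \<le> \<kappa> \<and> \<kappa> < m * q + q" if "\<kappa> div q = m"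
    using dividend_less_div_times[OF q_pos, of \<kappa>] div_times_less_eq_dividend[of \<kappa> q] that by auto
  show "\<kappa> div q = m" if "m * q \<le> \<kappa> \<and> \<kappa> < m * q + q"
    using that by (intro div_nat_eqI) (simp_all add: mult.commute)
qed

lemma card_block_boxes_in_row:
  assumes "i < n"
  shows "card {\<kappa> \<in> {..<num_diags}. i \<in> diag_rows \<kappa> \<and> \<kappa> div q = i + c} = d i c"
proof -
  have interval: "{x \<in> {a..<a + L}. a + b \<le> x \<and> x < a + b + k} = {a + b..<a + min L (b + k)}"
    for a b L k :: nat by auto
  have "{\<kappa> \<in> {..<num_diags}. i \<in> diag_rows \<kappa> \<and> \<kappa> div q = i + c}
      = {\<kappa> \<in> {i * q..<i * q + l i}. \<kappa> div q = i + c}"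
    unfolding diagonals_through_row[OF assms, symmetric] by blast
  also have "\<dots> = {i * q + c * q..<i * q + min (l i) (c * q + q)}"
    unfolding div_q_eq_iff add_mult_distrib by (rule interval)
  finally have "card {\<kappa> \<in> {..<num_diags}. i \<in> diag_rows \<kappa> \<and> \<kappa> div q = i + c} = min (l i) (c * q + q) - c * q"
    by (simp only: card_atLeastLessThan diff_add_inverse2 add_diff_cancel_left)
  then show ?thesis using min_shift[of i c] unfolding mult_Suc add.commute[of q] by (simp only:)
qed

lemma card_block_boxes_on_diagonal:
  assumes "\<kappa> < num_diags"
  shows "card {i \<in> {..<n}. i \<in> diag_rows \<kappa> \<and> \<kappa> div q = i + c} = of_bool (c < diag_len \<kappa>)"
proof -
  have "i < n" if "i \<in> {top_row \<kappa>..\<kappa> div q}" for i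
    using that by (intro diag_rows_less_n[of i \<kappa>]) (simp only: diag_rows_eq(1)[OF assms])
  then have "{i \<in> {..<n}. i \<in> diag_rows \<kappa> \<and> \<kappa> div q = i + c}
      = {i \<in> {top_row \<kappa>..\<kappa> div q}. \<kappa> div q = i + c}"
    unfolding diag_rows_eq(1)[OF assms] by blast
  also have "\<dots> = (if c < diag_len \<kappa> then {\<kappa> div q - c} else {})"
    using diag_len_eq[OF assms] by auto
  finally show ?thesis by simp
qed

text \<open>
  The boxes of block \<open>c\<close> are counted by rows on the left and by antidiagonals on the right: an antidiagonal
  meets blocks \<open>0, 1, 2, \<dots>\<close> in one box each until it ends.
\<close>

lemma digit_count: "(\<Sum>i<n. d i c) = (\<Sum>\<kappa><num_diags. of_bool (c < diag_len \<kappa>))"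
proof -
  have "(\<Sum>i<n. d i c) = (\<Sum>i<n. \<Sum>\<kappa><num_diags. of_bool (i \<in> diag_rows \<kappa> \<and> \<kappa> div q = i + c))"
    unfolding card_eq_sum_of_bool[OF finite_lessThan, symmetric]
    by (intro sum.cong refl card_block_boxes_in_row[symmetric]) simp
  also have "\<dots> = (\<Sum>\<kappa><num_diags. \<Sum>i<n. of_bool (i \<in> diag_rows \<kappa> \<and> \<kappa> div q = i + c))" by (rule sum.swap)
  also have "\<dots> = (\<Sum>\<kappa><num_diags. of_bool (c < diag_len \<kappa>))"
    unfolding card_eq_sum_of_bool[where A = "{..<n}", OF finite_lessThan, symmetric]
    by (intro sum.cong refl card_block_boxes_on_diagonal) simp
  finally show ?thesis .
qed

text \<open>
  \<open>\<epsilon>(\<lambda>)\<close> is congruent modulo 2 to \<open>\<Sum>j. \<gamma>\<^bsub>2j\<^esub>\<close>. Counted by antidiagonals, this sum is the number of pairs of an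
  antidiagonal and an even number not exceeding its length.
\<close>

lemma sign_eq: "(-1 :: 'k::field) powi eps p lam = (\<Prod>\<kappa><num_diags. (-1) ^ (diag_len \<kappa> div 2))"
proof -
  have "(\<Sum>j=1..M div 2. part (T_conjugate p lam) (2 * j)) = (\<Sum>j=1..M div 2. \<Sum>\<kappa><num_diags. of_bool (2 * j \<le> diag_len \<kappa>))"
  proof (rule sum.cong[OF refl])
    fix j assume j: "j \<in> {1..M div 2}"
    then have "2 * j = Suc (2 * j - 1)" "2 * j - 1 < M" by auto
    then have "part (T_conjugate p lam) (2 * j) = (\<Sum>i<n. d i (2 * j - 1))"
      using part_T_conjugate[of "2 * j - 1"] by simp
    also have "\<dots> = (\<Sum>\<kappa><num_diags. of_bool (2 * j \<le> diag_len \<kappa>))"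
      unfolding digit_count using j by (intro sum.cong) (auto simp: of_bool_def)
    finally show "part (T_conjugate p lam) (2 * j) = (\<Sum>\<kappa><num_diags. of_bool (2 * j \<le> diag_len \<kappa>))" .
  qed
  also have "\<dots> = (\<Sum>\<kappa><num_diags. \<Sum>j=1..M div 2. of_bool (2 * j \<le> diag_len \<kappa>))" by (rule sum.swap)
  also have "\<dots> = (\<Sum>\<kappa><num_diags. diag_len \<kappa> div 2)"
  proof (rule sum.cong[OF refl])
    fix \<kappa> assume "\<kappa> \<in> {..<num_diags}"
    then have "diag_len \<kappa> div 2 \<le> M div 2" using diag_len_le_M by (simp add: div_le_mono)
    then have "{j \<in> {1..M div 2}. 2 * j \<le> diag_len \<kappa>} = {1..diag_len \<kappa> div 2}" by auto
    then have "card {j \<in> {1..M div 2}. 2 * j \<le> diag_len \<kappa>} = diag_len \<kappa> div 2" by simp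
    then show "(\<Sum>j=1..M div 2. of_bool (2 * j \<le> diag_len \<kappa>)) = diag_len \<kappa> div 2" by (simp add: Int_def)
  qed
  finally have "even (eps p lam) \<longleftrightarrow> even (\<Sum>\<kappa><num_diags. diag_len \<kappa> div 2)"
    unfolding eps_def M_def[symmetric] even_alternating_sum by simp
  moreover have "(\<Prod>\<kappa><num_diags. (-1 :: 'k) ^ (diag_len \<kappa> div 2)) = (-1) ^ (\<Sum>\<kappa><num_diags. diag_len \<kappa> div 2)"
    by (simp add: power_sum)
  ultimately show ?thesis by (simp add: minus_one_powi)
qed

lemma lead_v_poly: "lead (v_poly p lam :: 'k::field mpoly) (spike_key p n l 1) ((-1) powi eps p lam)"
  unfolding v_poly_eq lead_exponent_eq[symmetric] sign_eq
  by (intro lead_prod lead_moore p_ge_2)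

lemma s_poly_eq: "(s_poly p lam :: 'k::field mpoly) = single (spike_key p n l 1) 1"
  unfolding s_poly_def by (rule leading_monomial_lead[OF lead_v_poly]) simp

text \<open>
  \<open>v(\<lambda>)\<close> is homogeneous as a product of Moore determinants. The degree is read off from the leading monomial.
\<close>

lemma homog_v_poly: "homog (\<Sum>i<n. mspike p (l i)) (v_poly p lam :: 'k::field mpoly)"
proof -
  define N where "N = (\<Sum>\<kappa><num_diags. \<Sum>a<diag_len \<kappa>. p ^ a)"
  have v: "homog N (v_poly p lam :: 'k mpoly)"
    unfolding v_poly_eq N_def by (intro homog_prod homog_moore)
  have "spike_key p n l 1 \<in> keys (v_poly p lam :: 'k mpoly)"
    using lead_v_poly[where 'k = 'k] by (auto simp: lead_def in_keys_iff)
  then have "tdeg (spike_key p n l 1) = N" using v by (auto simp: homog_def graded_def)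
  then show ?thesis using v by (simp add: tdeg_spike_key)
qed

text \<open>
  Row \<open>i\<close> is met by \<open>l i\<close> antidiagonals, and each contributes a power of \<open>p\<close> to the exponent.
\<close>

lemma keys_v_poly:
  assumes "e \<in> keys (v_poly p lam :: 'k::field mpoly)"
  shows "keys e \<subseteq> Suc ` {..<n}" "i < n \<Longrightarrow> dsum p (lookup e (Suc i)) \<le> l i"
proof -
  have "graded (\<lambda>_ e. keys e \<subseteq> Suc ` {..<n}) (\<Sum>\<kappa><num_diags. 0) (v_poly p lam :: 'k mpoly)"
    unfolding v_poly_eq
  proof (rule graded_prod[OF additive_family_support])
    fix \<kappa> assume "\<kappa> \<in> {..<num_diags}"
    then have "{Suc (top_row \<kappa>)..<Suc (top_row \<kappa>) + diag_len \<kappa>} = Suc ` diag_rows \<kappa>"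
      by (simp add: diag_rows_interval[symmetric])
    then have "{Suc (top_row \<kappa>)..<Suc (top_row \<kappa>) + diag_len \<kappa>} \<subseteq> Suc ` {..<n}"
      using diag_rows_less_n by auto
    then show "graded (\<lambda>_ e. keys e \<subseteq> Suc ` {..<n}) 0 (moore p (Suc (top_row \<kappa>)) (diag_len \<kappa>) :: 'k mpoly)"
      using graded_support_moore[of "Suc (top_row \<kappa>)" "diag_len \<kappa>" p, where 'a = 'k]
      unfolding graded_def by blast
  qed
  then show "keys e \<subseteq> Suc ` {..<n}" using assms by (simp add: graded_def)
  assume i: "i < n"
  have "graded (\<lambda>n e. dsum p (lookup e (Suc i)) \<le> n)
      (\<Sum>\<kappa><num_diags. if Suc (top_row \<kappa>) \<le> Suc i \<and> Suc i < Suc (top_row \<kappa>) + diag_len \<kappa> then 1 else 0) (v_poly p lam :: 'k mpoly)"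
    unfolding v_poly_eq by (intro graded_prod[OF additive_family_dsum_at] graded_dsum_moore p_ge_2)
  moreover have "(\<Sum>\<kappa><num_diags. if Suc (top_row \<kappa>) \<le> Suc i \<and> Suc i < Suc (top_row \<kappa>) + diag_len \<kappa> then 1 else 0)
      = (\<Sum>\<kappa><num_diags. if i \<in> diag_rows \<kappa> then 1 else (0::nat))"
    by (intro sum.cong refl) (auto simp flip: diag_rows_interval)
  moreover have "\<dots> = card {\<kappa> \<in> {..<num_diags}. i \<in> diag_rows \<kappa>}"
    by (simp add: sum.If_cases Int_def)
  moreover have "card {\<kappa> \<in> {..<num_diags}. i \<in> diag_rows \<kappa>} = l i"
    unfolding diagonals_through_row[OF i] by simp
  ultimately show "dsum p (lookup e (Suc i)) \<le> l i"
    using assms by (simp add: graded_def)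
qed

lemma milnor_spike_s_poly:
  assumes "CHAR('k::field) = p" "h \<le> 1"
  shows "milnor_spike p (drop (1 - h) lam) (s_poly p lam :: 'k mpoly) = p_poly p lam ^ p ^ h"
proof -
  have "homog (\<Sum>i<n. mspike p (l i)) (s_poly p lam :: 'k mpoly)"
    by (simp add: s_poly_eq homog_def graded_single tdeg_spike_key)
  then show ?thesis
    using assms by (simp only: milnor_spike_lam) (simp only: s_poly_eq lookup_hop_spike_monomial)
qed

lemma milnor_spike_v_poly:
  assumes k: "CHAR('k::field) = p" and h: "h \<le> 1"
  shows "milnor_spike p (drop (1 - h) lam) (v_poly p lam :: 'k mpoly)
    = cst ((-1) powi eps p lam) * p_poly p lam ^ p ^ h"
proof -
  have "lookup (v_poly p lam :: 'k mpoly) (spike_key p n l 1) = (-1) powi eps p lam"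
    using lead_v_poly[where 'k = 'k] by (simp add: lead_def)
  moreover have "lookup (hop p (n - 1 + h) (v_poly p lam :: 'k mpoly)) (spike_key p n l h)
      = cst (lookup (v_poly p lam) (spike_key p n l 1)) * p_poly p lam ^ p ^ h"
    unfolding lookup_hop_spike_monomial[OF k h, symmetric]
  proof (rule lookup_hop_eq_spike_coefficient[OF prime k homog_v_poly])
    fix e assume e: "e \<in> keys (v_poly p lam :: 'k mpoly)"
    show "keys e \<subseteq> Suc ` {..<n}" using e by (rule keys_v_poly(1))
    show "dsum p (lookup e (Suc i)) \<le> l i" if "i < n" for i using e that by (rule keys_v_poly(2))
  qed (rule weight_spike_key[OF p_ge_2])
  ultimately show ?thesis by (simp only: milnor_spike_lam[OF h homog_v_poly])
qed

end

section \<open>Multiples of column 2-regular partitions\<close>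

lemma prod_div_blocks: "0 < k \<Longrightarrow> (\<Prod>j<M * k. g (j div k)) = (\<Prod>c<M. g c ^ k :: 'a::comm_monoid_mult)"
proof (induction M)
  case (Suc M)
  have "(\<Prod>j<Suc M * k. g (j div k)) = (\<Prod>j<M * k. g (j div k)) * (\<Prod>j\<in>{M * k..<M * k + k}. g (j div k))"
    unfolding lessThan_atLeast0 by (subst prod.atLeastLessThan_concat) (simp_all add: add.commute)
  also have "(\<Prod>j\<in>{M * k..<M * k + k}. g (j div k)) = (\<Prod>j\<in>{M * k..<M * k + k}. g M)"
    by (intro prod.cong refl arg_cong[of _ _ g] div_nat_eqI) (simp_all add: mult.commute)
  finally show ?case using Suc by simp
qed simp

lemma mspike_multiple: "2 \<le> p \<Longrightarrow> mspike p ((p - 1) * k) = p ^ k - 1"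
proof -
  assume p: "2 \<le> p"
  have "mspike p ((p - 1) * k) = (\<Sum>c<k. min (p - 1) ((p - 1) * k - c * (p - 1)) * p ^ c)"
    by (rule mspike_eq_sum_digits[OF p]) (simp add: mult.commute)
  also have "\<dots> = (\<Sum>c<k. p ^ c * (p - 1))"
  proof (rule sum.cong[OF refl])
    fix c assume "c \<in> {..<k}"
    then have le: "(p - 1) * 1 \<le> (p - 1) * (k - c)" by (intro mult_le_mono2) auto
    have "(p - 1) * k - c * (p - 1) = (p - 1) * (k - c)"
      unfolding mult.commute[of c "p - 1"] by (rule diff_mult_distrib2[symmetric])
    then have "min (p - 1) ((p - 1) * k - c * (p - 1)) = p - 1"
      using le by (simp only: mult_1_right min_absorb1)
    then show "min (p - 1) ((p - 1) * k - c * (p - 1)) * p ^ c = p ^ c * (p - 1)" by simp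
  qed
  also have "\<dots> = p ^ k - 1"
    using repunit_eq[of p k] p by (simp add: sum_distrib_right)
  finally show ?thesis .
qed

context T_regular_partition
begin

context
  fixes \<kappa> assumes \<kappa>: "column_regular 2 \<kappa>" "lam = map (\<lambda>k. (p - 1) * k) \<kappa>"
begin

lemma n_multiple: "n = length \<kappa>"
  unfolding n_def unfolding \<kappa>(2) by simp

lemma l_multiple: "l i = q * part \<kappa> (Suc i)"
proof -
  have "lam ! i = q * \<kappa> ! i" if "i < length \<kappa>" using that by (simp add: \<kappa>(2) q_def)
  then show ?thesis using n_multiple by (auto simp: l_def part_def n_def Suc_le_eq)
qed

lemma multiple_less_l_iff: "j < l i \<longleftrightarrow> j div q < part \<kappa> (Suc i)"
  unfolding l_multiple using q_pos by (simp add: div_less_iff_less_mult mult.commute)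

lemma less_height_multiple_iff: "i < height c \<longleftrightarrow> c < part \<kappa> (Suc i)"
  unfolding less_height_iff multiple_less_l_iff using q_pos by simp

lemma M_multiple: "M = part \<kappa> 1"
proof -
  have "c < M \<longleftrightarrow> c < part \<kappa> 1" for c
    unfolding less_M_iff multiple_less_l_iff using q_pos by simp
  from this[of M] this[of "part \<kappa> 1"] have "\<not> M < part \<kappa> 1" "\<not> part \<kappa> 1 < M" by blast+
  then show ?thesis by linarith
qed

text \<open>
  The parts of \<open>\<kappa>\<close> decrease in steps of at most 1 and every value up to the largest occurs, so the columns of
  \<open>\<kappa>\<close> have distinct lengths.
\<close>

lemma height_strict:
  assumes "Suc c < M"
  shows "height (Suc c) < height c"
proof -
  define i where "i = height (Suc c) - 1"
  have i: "height (Suc c) = Suc i" using height_pos[OF assms] by (simp add: i_def)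
  have "i < n" using i height_le[of "Suc c"] by simp
  then have "Suc i \<in> {1..length \<kappa>}" by (simp add: n_multiple)
  then have "part \<kappa> (Suc i) - part \<kappa> (Suc i + 1) \<le> 2 - 1"
    using \<kappa>(1) unfolding column_regular_def by blast
  moreover have "Suc c < part \<kappa> (Suc i)" unfolding less_height_multiple_iff[symmetric] i by simp
  ultimately have "c < part \<kappa> (Suc (Suc i))" by simp
  then show ?thesis unfolding less_height_multiple_iff[symmetric] i .
qed

lemma height_decreasing: "j \<le> u \<Longrightarrow> u < M \<Longrightarrow> height u + (u - j) \<le> height j"
proof (induction u rule: dec_induct)
  case (step u)
  then show ?case using height_strict[of u] by simp
qed simp

lemma d_multiple: "d i c = (if i < height c then q else 0)"
proof (cases "i < height c")
  case True
  then have "c < part \<kappa> (Suc i)" by (rule less_height_multiple_iff[THEN iffD1])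
  then have "q * 1 \<le> q * (part \<kappa> (Suc i) - c)" by (intro mult_le_mono2) simp
  then show ?thesis using True by (simp add: d_def l_multiple diff_mult_distrib2 mult.commute)
next
  case False
  then show ?thesis using less_height_iff[of i c] by (simp add: d_def)
qed

lemma T_conjugate_multiple: "T_conjugate p lam = map (\<lambda>c. q * height c) [0..<M]"
proof -
  have "(\<Sum>i<n. d i c) = (\<Sum>i<height c. q)" for c
    unfolding d_multiple using height_le[of c]
    by (intro sum.mono_neutral_cong_right) auto
  then show ?thesis
    unfolding T_conjugate_def map_upt_from_1 M_def[symmetric] card_block by (simp add: mult.commute)
qed

lemma w_prod_multiple: "w_prod p (conj_partition lam) = (\<Prod>c<M. w_poly p (height c) ^ q :: 'k::comm_ring_1 mpoly)"
proof -
  have l0: "part lam 1 = M * q"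
    unfolding M_multiple using l_multiple[of 0] by (simp add: l_def mult.commute)
  have "card {i. i < length lam \<and> j < lam ! i} = height (j div q)" for j
  proof -
    have "{i. i < length lam \<and> j < lam ! i} = {i. j < l i}"
      using l_beyond by (auto simp: l_def part_def n_def)
    also have "\<dots> = {..<height (j div q)}"
      unfolding multiple_less_l_iff less_height_multiple_iff[symmetric] by blast
    finally show ?thesis by simp
  qed
  then show ?thesis
    unfolding w_prod_eq l0 using prod_div_blocks[OF q_pos, of "\<lambda>c. w_poly p (height c)" M] by simp
qed

text \<open>
  The homogenization works out because \<open>w(k)\<^bsup>p-1\<^esup>\<close> has degree \<open>p\<^sup>k - 1\<close>, which is the spike entry of
  \<open>(p - 1) k\<close>.
\<close>

lemma milnor_spike_w_prod:
  assumes k: "CHAR('k::field) = p" and h: "h \<le> 1"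
  shows "milnor_spike p (drop (1 - h) (T_conjugate p lam)) (w_prod p (conj_partition lam) :: 'k mpoly)
    = p_poly p lam ^ p ^ h"
proof -
  let ?w = "w_prod p (conj_partition lam) :: 'k mpoly"
  define \<gamma> where "\<gamma> = T_conjugate p lam"
  define R where "R = spike_key p M (\<lambda>i. part \<gamma> (Suc i)) h"
  define t where "t = M - 1 + h"
  interpret hop: comm_ring_hom "hop p t :: 'k mpoly \<Rightarrow> _" by (rule comm_ring_hom_hop)
  have len: "length \<gamma> = M" by (simp add: \<gamma>_def T_conjugate_multiple)
  have \<gamma>: "\<gamma> ! c = q * height c" if "c < M" for c
    using that by (simp add: \<gamma>_def T_conjugate_multiple)
  have spike: "mspike p (part \<gamma> (Suc c)) = p ^ height c - 1" if "c < M" for c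
    using that mspike_multiple[OF p_ge_2, of "height c"] by (simp add: part_def len \<gamma> q_def)
  have "homog (\<Sum>c<M. q * (\<Sum>a<height c. p ^ a)) ?w"
    unfolding w_prod_multiple w_poly_eq_moore by (intro homog_prod homog_power homog_moore)
  moreover have "(\<Sum>c<M. q * (\<Sum>a<height c. p ^ a)) = (\<Sum>i<length \<gamma>. mspike p (part \<gamma> (Suc i)))"
    unfolding len
  proof (rule sum.cong[OF refl])
    fix c assume "c \<in> {..<M}"
    then show "q * (\<Sum>a<height c. p ^ a) = mspike p (part \<gamma> (Suc c))"
      using spike repunit_eq[of p "height c"] p_ge_2 by (simp add: q_def mult.commute)
  qed
  ultimately have homog: "homog (\<Sum>i<length \<gamma>. mspike p (part \<gamma> (Suc i))) ?w" by (simp only:)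
  have "milnor_spike p (drop (1 - h) \<gamma>) ?w = lookup (hop p t ?w) R"
    unfolding R_def t_def len[symmetric]
  proof (rule milnor_spike_eq_lookup[OF _ _ h homog])
    show "0 < \<gamma> ! i" if "i < length \<gamma>" for i
      using that \<gamma>[of i] height_pos[of i] q_pos by (simp add: len)
    show "\<gamma> \<noteq> []" using len M_pos by auto
  qed
  also have "hop p t ?w = (\<Prod>c<M. hop p t (w_poly p (height c)) ^ (p - 1))"
    unfolding w_prod_multiple by (simp add: hop.hom_prod hop.hom_power q_def)
  also have "lookup \<dots> R
    = lookup (cst (\<Prod>c<M. (w_poly p (height c) ^ (p - 1)) ^ p ^ (c + h)) * (\<Prod>u<M. var (u + h) ^ (p ^ height u - 1))) R"
  proof (rule lookup_eq_of_null, rule hop_w_powers_mod_null[OF prime k height_decreasing])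
    show "M + h = Suc t" using M_pos by (simp add: t_def)
    show "lookup R (u + h) = p ^ height u - 1" if "u < M" for u
      using that spike by (simp add: R_def lookup_spike_key)
    show "lookup R u = 0" if "u < h \<or> M + h \<le> u" for u
      using that by (auto simp: R_def lookup_spike_key)
  qed
  also have "(\<Prod>u<M. var (u + h) ^ (p ^ height u - 1)) = (single R 1 :: 'k mpoly mpoly)"
    using spike by (simp add: var_power prod_single R_def spike_key_def)
  also have "lookup (cst (\<Prod>c<M. (w_poly p (height c) ^ (p - 1)) ^ p ^ (c + h)) * single R 1) R
      = (\<Prod>c<M. ((w_poly p (height c) ^ q) ^ p ^ c) ^ p ^ h)"
    by (simp add: cst_mult_single q_def power_add power_mult)
  also have "\<dots> = p_poly p lam ^ p ^ h"
  proof -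
    have "d (height c - 1) c = q" if "c < M" for c
      using height_pos[OF that] by (simp add: d_multiple)
    then show ?thesis by (simp add: p_poly_eq prod_power_distrib)
  qed
  finally show ?thesis by (simp add: \<gamma>_def)
qed

end
end

theorem theorem8p1:
  fixes p :: nat and lam :: "nat list"
  assumes "prime p" and "odd p" and card_k: "card (UNIV :: 'k::field set) = p"
    and "lam \<noteq> []" and "last lam \<noteq> 0" and "T_regular p lam"
  shows
    "(milnor_spike p (tl lam) (s_poly p lam :: 'k mpoly)
        = cst ((-1) powi eps p lam) * milnor_spike p (tl lam) (v_poly p lam)
      \<and> cst ((-1) powi eps p lam) * milnor_spike p (tl lam) (v_poly p lam) = (p_poly p lam :: 'k mpoly))
   \<and> (\<forall>\<kappa>. column_regular 2 \<kappa> \<and> lam = map (\<lambda>k. (p - 1) * k) \<kappa> \<longrightarrow>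
        milnor_spike p (tl (T_conjugate p lam)) (w_prod p (conj_partition lam))
          = (p_poly p lam :: 'k mpoly))
   \<and> (milnor_spike p lam (s_poly p lam :: 'k mpoly)
        = cst ((-1) powi eps p lam) * milnor_spike p lam (v_poly p lam)
      \<and> cst ((-1) powi eps p lam) * milnor_spike p lam (v_poly p lam) = (p_poly p lam :: 'k mpoly) ^ p)
   \<and> (\<forall>\<kappa>. column_regular 2 \<kappa> \<and> lam = map (\<lambda>k. (p - 1) * k) \<kappa> \<longrightarrow>
        milnor_spike p (T_conjugate p lam) (w_prod p (conj_partition lam))
          = (p_poly p lam :: 'k mpoly) ^ p)"
proof -
  interpret T_regular_partition p lam
    using assms(1,4,5,6) by unfold_locales
  have k: "CHAR('k) = p" using assms(1) card_k by (rule CHAR_finite_prime_field)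
  let ?sgn = "cst ((-1) powi eps p lam) :: 'k mpoly"
  have "((-1 :: 'k) powi eps p lam) * ((-1) powi eps p lam) = 1" by (simp add: minus_one_powi)
  then have sgn: "?sgn * (?sgn * f) = f" for f
    by (simp only: mult.assoc[symmetric] cst_mult[symmetric]) simp
  show ?thesis
    using milnor_spike_s_poly[OF k, of 0] milnor_spike_s_poly[OF k, of 1]
      milnor_spike_v_poly[OF k, of 0] milnor_spike_v_poly[OF k, of 1]
      milnor_spike_w_prod[OF _ _ k, of _ 0] milnor_spike_w_prod[OF _ _ k, of _ 1]
    by (simp add: drop_Suc sgn)
qed

end
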